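(* Let $\nabla$ be a compressed lattice polytope. If $\nabla$ contains no neighbouring singular vertices (i.e. no two singular vertices of $\nabla$ are neighbours), then the toric ideal of $\nabla$ is generated by its quadratic elements.
   Context: A lattice polytope $\nabla\subset\mathbb{R}^d$ is the convex hull of a finite subset of $\mathbb{Z}^d$. Write its facet presentation as $\nabla=\{x\mid\langle x,a_F\rangle\ge c_F\text{ for all facets }F\}$, where $a_F$ is the primitive integer normal vector of the facet $F$ (if $\nabla$ is not full-dimensional, this is understood inside the affine span of $\nabla$ with its induced lattice). The width of $\nabla$ with respect to $F$ is $\max_{x\in\nabla}\{\langle x,a_F\rangle-c_F\}$. $\nabla$ is compressed if it has width one with respect to all of its facets. Compressed polytopes are normal: every lattice point of $k\nabla$ is a sum of $k$ lattice points of $\nabla$, for all $k\ge1$. A vertex $v$ of $\nabla$ is smooth if the ray generators of $\mathrm{Cone}(\nabla-v)=\{\lambda x\mid x\in\nabla-v,\ \lambda\in\mathbb{R}_{\geq 0}\}$ (the lattice points closest to the origin on its edges) form part of a $\mathbb{Z}$-basis of $\mathbb{Z}^d$; otherwise $v$ is singular. Two vertices of a lattice polytope are neighbours if they lie on the same edge with no intermediate lattice point. Toric ideal: if $\nabla$ has lattice points $m_1,\dots,m_k$, let $S(\nabla)=\{(m,\lambda)\in\mathbb{Z}^d\times\mathbb{Z}\mid \lambda\ge 0,\ m\in\lambda\nabla\}$ and let $\varphi:\mathbb{C}[t_1,\dots,t_k]\to\mathbb{C}[S(\nabla)]$ be the $\mathbb{C}$-algebra surjection $t_i\mapsto x^{(m_i,1)}$.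 The toric ideal of $\nabla$ is $\ker\varphi$, homogeneous for the standard grading (degrees refer to this grading; the zero ideal counts as generated by quadratic elements). *)

theory Defs
  imports "HOL-Analysis.Analysis" "HOL-Algebra.RingHom" "HOL-Library.Poly_Mapping"
begin

section \<open>Lattice polytopes\<close>

definition int_lattice :: "(real ^ 'n) set" where
  "int_lattice = {x. \<forall>i. x $ i \<in> \<int>}"

definition lattice_polytope :: "(real ^ 'n) set \<Rightarrow> bool" where
  "lattice_polytope P \<longleftrightarrow> (\<exists>V. finite V \<and> V \<subseteq> int_lattice \<and> P = convex hull V)"

definition lattice_points :: "(real ^ 'n) set \<Rightarrow> (real ^ 'n) set" where
  "lattice_points P = P \<inter> int_lattice"

section \<open>Facet widths and compressed polytopes\<close>

text \<open>The linear space parallel to the affine span of \<open>P\<close>, and the lattice that \<open>\<int>\<^sup>d\<close> induces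
  on it. For a full-dimensional \<open>P\<close> these are the whole space and \<open>int_lattice\<close>.\<close>

definition direction_space :: "(real ^ 'n) set \<Rightarrow> (real ^ 'n) set" where
  "direction_space P = span {x - y | x y. x \<in> P \<and> y \<in> P}"

definition induced_lattice :: "(real ^ 'n) set \<Rightarrow> (real ^ 'n) set" where
  "induced_lattice P = direction_space P \<inter> int_lattice"

text \<open>Integer linear forms on the induced lattice, represented through the inner product by
  vectors of the direction space. If \<open>P\<close> is full-dimensional, these are exactly the integer
  vectors; otherwise the representing vector need not have integer coordinates.\<close>

definition dual_lattice :: "(real ^ 'n) set \<Rightarrow> (real ^ 'n) set" where
  "dual_lattice P = {a \<in> direction_space P. \<forall>x \<in> induced_lattice P. a \<bullet> x \<in> \<int>}"

text \<open>The zero form is not primitive, as it is twice itself.\<close>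

definition primitive_normal :: "(real ^ 'n) set \<Rightarrow> real ^ 'n \<Rightarrow> bool" where
  "primitive_normal P a \<longleftrightarrow>
     a \<in> dual_lattice P \<and>
     (\<forall>b \<in> dual_lattice P. \<forall>k::int. a = of_int k *\<^sub>R b \<longrightarrow> \<bar>k\<bar> = 1)"

text \<open>\<open>facet_inequality P F a c\<close>: the inequality \<open>\<langle>x, a\<rangle> \<ge> c\<close> is the one belonging to \<open>F\<close> in the
  facet presentation of \<open>P\<close>. For a facet of a lattice polytope, \<open>a\<close> and \<open>c\<close> exist and are unique.\<close>

definition facet_inequality :: "(real ^ 'n) set \<Rightarrow> (real ^ 'n) set \<Rightarrow> real ^ 'n \<Rightarrow> real \<Rightarrow> bool" where
  "facet_inequality P F a c \<longleftrightarrow>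
     primitive_normal P a \<and> (\<forall>x \<in> P. x \<bullet> a \<ge> c) \<and> F = {x \<in> P. x \<bullet> a = c}"

definition width :: "(real ^ 'n) set \<Rightarrow> real ^ 'n \<Rightarrow> real \<Rightarrow> real" where
  "width P a c = (SUP x \<in> P. x \<bullet> a - c)"

definition compressed :: "(real ^ 'n) set \<Rightarrow> bool" where
  "compressed P \<longleftrightarrow>
     (\<forall>F. F facet_of P \<longrightarrow> (\<exists>a c. facet_inequality P F a c \<and> width P a c = 1))"

section \<open>Smooth and singular vertices\<close>

definition is_vertex :: "(real ^ 'n) set \<Rightarrow> real ^ 'n \<Rightarrow> bool" where
  "is_vertex P v \<longleftrightarrow> v extreme_point_of P"

definition vertex_cone :: "(real ^ 'n) set \<Rightarrow> real ^ 'n \<Rightarrow> (real ^ 'n) set" where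
  "vertex_cone P v = {l *\<^sub>R (x - v) | l x. 0 \<le> l \<and> x \<in> P}"

text \<open>At a vertex the cone is pointed, so its one-dimensional faces are rays from the origin.\<close>

definition ray_generators :: "(real ^ 'n) set \<Rightarrow> (real ^ 'n) set" where
  "ray_generators C =
     {u. \<exists>E. E edge_of C \<and> u \<in> E \<inter> int_lattice - {0} \<and>
             (\<forall>w \<in> E \<inter> int_lattice - {0}. norm u \<le> norm w)}"

definition int_basis :: "(real ^ 'n) set \<Rightarrow> bool" where
  "int_basis B \<longleftrightarrow>
     finite B \<and>
     {(\<Sum>b\<in>B. of_int (c b) *\<^sub>R b) | c :: real ^ 'n \<Rightarrow> int. True} = int_lattice \<and>
     (\<forall>c :: real ^ 'n \<Rightarrow> int. (\<Sum>b\<in>B. of_int (c b) *\<^sub>R b) = 0 \<longrightarrow> (\<forall>b\<in>B. c b = 0))"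

definition smooth_vertex :: "(real ^ 'n) set \<Rightarrow> real ^ 'n \<Rightarrow> bool" where
  "smooth_vertex P v \<longleftrightarrow>
     is_vertex P v \<and> (\<exists>B. int_basis B \<and> ray_generators (vertex_cone P v) \<subseteq> B)"

definition singular_vertex :: "(real ^ 'n) set \<Rightarrow> real ^ 'n \<Rightarrow> bool" where
  "singular_vertex P v \<longleftrightarrow> is_vertex P v \<and> \<not> smooth_vertex P v"

definition neighbours :: "(real ^ 'n) set \<Rightarrow> real ^ 'n \<Rightarrow> real ^ 'n \<Rightarrow> bool" where
  "neighbours P v w \<longleftrightarrow>
     is_vertex P v \<and> is_vertex P w \<and> v \<noteq> w \<and>
     (\<exists>E. E edge_of P \<and> v \<in> E \<and> w \<in> E) \<and>
     open_segment v w \<inter> int_lattice = {}"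

section \<open>The toric ideal\<close>

text \<open>Both rings consist of finitely supported functions with the convolution product of
  \<^theory>\<open>HOL-Library.Poly_Mapping\<close>. Polynomials have one variable \<open>t\<^sub>m\<close> for each lattice point
  \<open>m\<close>, used as its own index; an exponent is a finitely supported \<open>nat\<close>-valued function on them.\<close>

definition coordinate_ring :: "'v set \<Rightarrow> (('v \<Rightarrow>\<^sub>0 nat) \<Rightarrow>\<^sub>0 complex) ring" where
  "coordinate_ring X =
     \<lparr>carrier = {p. \<forall>e \<in> Poly_Mapping.keys p. Poly_Mapping.keys e \<subseteq> X},
      mult = (*), one = 1, zero = 0, add = (+)\<rparr>"

definition polytope_semigroup :: "(real ^ 'n) set \<Rightarrow> ((real ^ 'n) \<times> int) set" where
  "polytope_semigroup P =
     {(m, l). m \<in> int_lattice \<and> 0 \<le> l \<and> m \<in> (\<lambda>x. of_int l *\<^sub>R x) ` P}"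

definition semigroup_ring :: "'s::comm_monoid_add set \<Rightarrow> ('s \<Rightarrow>\<^sub>0 complex) ring" where
  "semigroup_ring S =
     \<lparr>carrier = {q. Poly_Mapping.keys q \<subseteq> S},
      mult = (*), one = 1, zero = 0, add = (+)\<rparr>"

text \<open>The \<open>\<complex>\<close>-algebra homomorphism \<open>t\<^sub>m \<mapsto> x\<^bsup>(m, 1)\<^esup>\<close>.\<close>

definition toric_hom ::
    "((real ^ 'n \<Rightarrow>\<^sub>0 nat) \<Rightarrow>\<^sub>0 complex) \<Rightarrow> ((real ^ 'n) \<times> int \<Rightarrow>\<^sub>0 complex)" where
  "toric_hom p =
     (\<Sum>e \<in> Poly_Mapping.keys p.
        Poly_Mapping.single 0 (Poly_Mapping.lookup p e) *
        (\<Prod>m \<in> Poly_Mapping.keys e.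
           Poly_Mapping.single (m, 1) 1 ^ Poly_Mapping.lookup e m))"

definition toric_ideal :: "(real ^ 'n) set \<Rightarrow> ((real ^ 'n \<Rightarrow>\<^sub>0 nat) \<Rightarrow>\<^sub>0 complex) set" where
  "toric_ideal P =
     a_kernel (coordinate_ring (lattice_points P)) (semigroup_ring (polytope_semigroup P)) toric_hom"

definition homogeneous_of_degree :: "nat \<Rightarrow> (('v \<Rightarrow>\<^sub>0 nat) \<Rightarrow>\<^sub>0 complex) \<Rightarrow> bool" where
  "homogeneous_of_degree d p \<longleftrightarrow>
     (\<forall>e \<in> Poly_Mapping.keys p. (\<Sum>m \<in> Poly_Mapping.keys e. Poly_Mapping.lookup e m) = d)"

end

theory Submission
  imports Defs "HOL-Library.Multiset"
begin

text \<open>In a compressed polytope \<open>P\<close> every facet \<open>F\<close> has an integral height function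
  that takes only the values \<open>0\<close> and \<open>1\<close> on lattice points, so lattice points are
  \<open>0/1\<close>-vectors indexed by the facets, and a point of the affine lattice belongs to
  \<open>P\<close> as soon as its heights are nonnegative.

  The toric ideal is spanned by binomials that compare two multisets of lattice points with the same size
  and the same sum. Such a binomial lies in the ideal of the quadrics if one multiset can be turned into the
  other by exchanges that replace two members by two lattice points with the same sum
  (\<open>exchange_equiv\<close>). It remains to connect all multisets of the same size and sum.

  This goes by induction on the size: it is enough to make both multisets contain a common point
  \<open>v\<close> (\<open>exchange_reaches_origin\<close>). Consider the smallest face that contains the
  members. If it is a single point, the multisets are equal. Otherwise it has an edge whose ends are
  neighbouring vertices (\<open>adjacent_pair_exists\<close>, \<open>adjacent_imp_neighbours\<close>), hence
  one end \<open>v\<close> is smooth.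

  Smoothness enters through one consequence only (\<open>smooth_vertex_imp_simple\<close>): each facet
  \<open>F\<close> at \<open>v\<close> can be left towards a lattice point \<open>y F\<close> that stays on
  all other facets at \<open>v\<close>. In the coordinates with origin \<open>v\<close> and axis points
  \<open>y F\<close>, the lattice points are \<open>0/1\<close>-vectors, and a facet \<open>G\<close> away
  from \<open>v\<close> says that at most one coordinate in a certain set \<open>clique G\<close> is nonzero
  (\<open>far_height\<close>). So the lattice points are the stable sets of a graph on the facets at
  \<open>v\<close>, in which two facets are joined if they lie in a common clique. An axis in two different
  cliques (\<open>branching\<close>) has an axis point that is not simple, hence singular, and two axis
  points in a common clique are neighbours. The hypothesis therefore implies that a clique contains at most
  one branching axis.

  By the choice of \<open>v\<close>, each facet \<open>G\<close> away from \<open>v\<close> is missed by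
  some member of the multiset, that is, some member, as a stable set, has no element in \<open>clique
  G\<close>. Suppose the member to be turned into \<open>v\<close>, the empty stable set, contains an axis
  \<open>F\<close> that is not branching. Then \<open>F\<close> can be moved to a member that avoids the
  only clique of \<open>F\<close>. If it contains a branching axis \<open>W\<close>, swap \<open>W\<close>
  with the neighbours of \<open>W\<close> in a member that avoids one clique of \<open>W\<close>; those
  neighbours are not branching. The first exchange lowers the number of elements and the second the number
  of branching elements, so the process ends with \<open>v\<close> (\<open>exchange_step\<close>).\<close>

section \<open>Exchanges in multisets of points\<close>

text \<open>A multiset stands for the monomial in its members, and an exchange adds a monomial multiple of a quadratic
  binomial of the toric ideal. The multiplier \<open>C\<close> is confined to \<open>L\<close> because only
  points of \<open>L\<close> index variables.\<close>

inductive exchange_equiv :: "'a::comm_monoid_add set \<Rightarrow> 'a multiset \<Rightarrow> 'a multiset \<Rightarrow> bool"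
  for L where
  exchange: "\<lbrakk>x \<in> L; y \<in> L; x' \<in> L; y' \<in> L; x + y = x' + y'\<rbrakk>
    \<Longrightarrow> exchange_equiv L {#x, y#} {#x', y'#}"
| refl: "exchange_equiv L M M"
| sym: "exchange_equiv L M N \<Longrightarrow> exchange_equiv L N M"
| trans: "exchange_equiv L M N \<Longrightarrow> exchange_equiv L N K \<Longrightarrow> exchange_equiv L M K"
| add: "exchange_equiv L M N \<Longrightarrow> set_mset C \<subseteq> L \<Longrightarrow> exchange_equiv L (M + C) (N + C)"

lemma exchange_equiv_sum_mset:
  "exchange_equiv L M N \<Longrightarrow> sum_mset M = sum_mset N"
  by (induction rule: exchange_equiv.induct) auto

lemma exchange_equiv_size:
  "exchange_equiv L M N \<Longrightarrow> size M = size N"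
  by (induction rule: exchange_equiv.induct) auto

section \<open>Points with heights zero and one over finitely many facets\<close>

text \<open>What the combinatorial part uses of a compressed polytope: \<open>A\<close> is the lattice in the affine
  span, \<open>h F\<close> the height over the facet \<open>F\<close>, and \<open>L\<close> the set of
  lattice points.\<close>

locale facet_system =
  fixes A :: "'a::ab_group_add set" and \<Phi> :: "'f set" and h :: "'f \<Rightarrow> 'a \<Rightarrow> int"
    and L :: "'a set"
  assumes finite_facets: "finite \<Phi>"
    and affine_closed: "\<lbrakk>x \<in> A; y \<in> A; z \<in> A\<rbrakk> \<Longrightarrow> x + (y - z) \<in> A"
    and height_affine: "\<lbrakk>F \<in> \<Phi>; x \<in> A; y \<in> A; z \<in> A\<rbrakk> \<Longrightarrow> h F (x + (y - z)) = h F x + (h F y - h F z)"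
    and points_eq: "L = {x \<in> A. \<forall>F\<in>\<Phi>. 0 \<le> h F x}"
    and height_le_1: "\<lbrakk>x \<in> L; F \<in> \<Phi>\<rbrakk> \<Longrightarrow> h F x \<le> 1"
    and heights_inj: "\<lbrakk>x \<in> L; y \<in> L; \<And>F. F \<in> \<Phi> \<Longrightarrow> h F x = h F y\<rbrakk> \<Longrightarrow> x = y"
begin

text \<open>The facets at \<open>v\<close> are independent: each of them can be left while staying on the others. In a
  compressed polytope these are the simple vertices.\<close>

definition simple_point :: "'a \<Rightarrow> bool" where
  "simple_point v \<longleftrightarrow> v \<in> L \<and> (\<forall>F\<in>\<Phi>. h F v = 0 \<longrightarrow>
     (\<exists>y\<in>L. h F y = 1 \<and> (\<forall>F'\<in>\<Phi> - {F}. h F' v = 0 \<longrightarrow> h F' y = 0)))"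

text \<open>The smallest face that contains \<open>a\<close> and \<open>b\<close> has no further lattice point.\<close>

definition adjacent :: "'a \<Rightarrow> 'a \<Rightarrow> bool" where
  "adjacent a b \<longleftrightarrow> a \<in> L \<and> b \<in> L \<and> a \<noteq> b \<and>
     (\<forall>c\<in>L. (\<forall>F\<in>\<Phi>. h F a = h F b \<longrightarrow> h F c = h F a) \<longrightarrow> c = a \<or> c = b)"

lemma point_affine: "x \<in> L \<Longrightarrow> x \<in> A"
  by (simp add: points_eq)

lemma height_cases: "x \<in> L \<Longrightarrow> F \<in> \<Phi> \<Longrightarrow> h F x = 0 \<or> h F x = 1"
  using height_le_1[of x F] unfolding points_eq by force

lemma translate_sum:
  assumes "x \<in> A" "v \<in> A" "finite T" "\<And>F. F \<in> T \<Longrightarrow> y F \<in> A"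
  shows "x + (\<Sum>F\<in>T. y F - v) \<in> A \<and> x - (\<Sum>F\<in>T. y F - v) \<in> A \<and>
    (\<forall>G\<in>\<Phi>. h G (x + (\<Sum>F\<in>T. y F - v)) = h G x + (\<Sum>F\<in>T. h G (y F) - h G v) \<and>
            h G (x - (\<Sum>F\<in>T. y F - v)) = h G x - (\<Sum>F\<in>T. h G (y F) - h G v))"
  using assms(3,4)
proof (induction T rule: finite_induct)
  case empty
  then show ?case using assms by simp
next
  case (insert F T)
  let ?s = "\<Sum>F\<in>T. y F - v"
  have IH: "x + ?s \<in> A" "x - ?s \<in> A"
    "\<And>G. G \<in> \<Phi> \<Longrightarrow> h G (x + ?s) = h G x + (\<Sum>F\<in>T. h G (y F) - h G v)"
    "\<And>G. G \<in> \<Phi> \<Longrightarrow> h G (x - ?s) = h G x - (\<Sum>F\<in>T. h G (y F) - h G v)"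
    using insert by auto
  have yF: "y F \<in> A" using insert by simp
  have e: "x + (\<Sum>F\<in>insert F T. y F - v) = (x + ?s) + (y F - v)"
    "x - (\<Sum>F\<in>insert F T. y F - v) = (x - ?s) + (v - y F)"
    using insert by (simp_all add: algebra_simps)
  have s: "(\<Sum>F\<in>insert F T. h G (y F) - h G v) = (h G (y F) - h G v) + (\<Sum>F\<in>T. h G (y F) - h G v)" for G
    using insert by simp
  show ?case unfolding e s
    using affine_closed[OF IH(1) yF assms(2)] affine_closed[OF IH(2) assms(2) yF]
      height_affine[OF _ IH(1) yF assms(2)] height_affine[OF _ IH(2) assms(2) yF] IH(3,4)
    by auto
qed

end

text \<open>A simple point \<open>v\<close> as origin, with a chosen point \<open>y F\<close> on each axis; the axis
  of a facet \<open>F\<close> at \<open>v\<close> is the line on which all other facets at \<open>v\<close>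
  are kept.\<close>

locale facet_chart = facet_system A \<Phi> h L
  for A :: "'a::ab_group_add set" and \<Phi> :: "'f set" and h :: "'f \<Rightarrow> 'a \<Rightarrow> int" and L +
  fixes v :: 'a and y :: "'f \<Rightarrow> 'a"
  assumes origin: "v \<in> L"
    and axis: "\<lbrakk>F \<in> \<Phi>; h F v = 0\<rbrakk> \<Longrightarrow> y F \<in> L"
    and axis_off: "\<lbrakk>F \<in> \<Phi>; h F v = 0\<rbrakk> \<Longrightarrow> h F (y F) = 1"
    and axis_on: "\<lbrakk>F \<in> \<Phi>; h F v = 0; F' \<in> \<Phi>; h F' v = 0; F' \<noteq> F\<rbrakk> \<Longrightarrow> h F' (y F) = 0"
begin

definition local_facets where "local_facets = {F \<in> \<Phi>. h F v = 0}"

definition far_facets where "far_facets = {G \<in> \<Phi>. h G v = 1}"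

definition support where "support x = {F \<in> local_facets. h F x = 1}"

text \<open>In the coordinates at \<open>v\<close>, the facet \<open>G\<close> is the inequality that the coordinates
  in \<open>clique G\<close> have sum at most one.\<close>

definition clique where "clique G = {F \<in> local_facets. h G (y F) = 0}"

definition displacement where "displacement T = (\<Sum>F\<in>T. y F - v)"

text \<open>Join two axes if they lie in a common clique. An axis outside \<open>branching\<close> lies in just one
  clique, so its neighbours in this graph are pairwise joined.\<close>

definition branching where
  "branching = {F \<in> local_facets. \<exists>G\<in>far_facets. \<exists>G'\<in>far_facets. G \<noteq> G' \<and> F \<in> clique G \<and> F \<in> clique G'}"

lemma facets_cases: "\<Phi> = local_facets \<union> far_facets"
  using height_cases[OF origin] by (auto simp: local_facets_def far_facets_def)

lemma finite_local [simp]: "finite local_facets" "T \<subseteq> local_facets \<Longrightarrow> finite T"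
  "finite (support x)" "finite (clique G)"
  using finite_facets finite_subset[of _ \<Phi>]
  by (auto simp: local_facets_def support_def clique_def intro: finite_subset[of _ \<Phi>])

lemma support_subset: "support x \<subseteq> local_facets" by (auto simp: support_def)

lemma displacement_height:
  assumes x: "x \<in> A" and T: "T \<subseteq> local_facets"
  shows "x + displacement T \<in> A" "x - displacement T \<in> A"
    "F \<in> local_facets \<Longrightarrow> h F (x + displacement T) = h F x + (if F \<in> T then 1 else 0)"
    "F \<in> local_facets \<Longrightarrow> h F (x - displacement T) = h F x - (if F \<in> T then 1 else 0)"
    "G \<in> far_facets \<Longrightarrow> h G (x + displacement T) = h G x - int (card (T \<inter> clique G))"
    "G \<in> far_facets \<Longrightarrow> h G (x - displacement T) = h G x + int (card (T \<inter> clique G))"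
proof -
  have fin: "finite T" using T by simp
  have yA: "\<And>F. F \<in> T \<Longrightarrow> y F \<in> A" using T axis by (auto simp: local_facets_def intro: point_affine)
  note t = translate_sum[OF x point_affine[OF origin] fin, of y, OF yA, folded displacement_def]
  show "x + displacement T \<in> A" "x - displacement T \<in> A" using t by auto
  have local: "(\<Sum>F'\<in>T. h F (y F') - h F v) = (if F \<in> T then 1 else 0)" if "F \<in> local_facets" for F
  proof -
    have "(\<Sum>F'\<in>T. h F (y F') - h F v) = (\<Sum>F'\<in>T. if F = F' then 1 else 0)"
      using T that axis_off axis_on by (intro sum.cong) (auto simp: local_facets_def)
    then show ?thesis using fin by simp
  qed
  have far: "(\<Sum>F'\<in>T. h G (y F') - h G v) = - int (card (T \<inter> clique G))" if "G \<in> far_facets" for G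
  proof -
    have "h G (y F') - h G v = - (if F' \<in> clique G then 1 else 0)" if "F' \<in> T" for F'
      using T that \<open>G \<in> far_facets\<close> height_cases[OF axis, of F' G]
      by (auto simp: clique_def local_facets_def far_facets_def)
    then have "(\<Sum>F'\<in>T. h G (y F') - h G v) = (\<Sum>F'\<in>T. - (if F' \<in> clique G then 1 else 0))"
      by (intro sum.cong) auto
    also have "\<dots> = - int (card (T \<inter> clique G))"
      using fin by (simp add: sum_negf sum.If_cases Int_def)
    finally show ?thesis .
  qed
  show "F \<in> local_facets \<Longrightarrow> h F (x + displacement T) = h F x + (if F \<in> T then 1 else 0)"
    "F \<in> local_facets \<Longrightarrow> h F (x - displacement T) = h F x - (if F \<in> T then 1 else 0)"
    "G \<in> far_facets \<Longrightarrow> h G (x + displacement T) = h G x - int (card (T \<inter> clique G))"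
    "G \<in> far_facets \<Longrightarrow> h G (x - displacement T) = h G x + int (card (T \<inter> clique G))"
    using t local far by (auto simp: local_facets_def far_facets_def)
qed

lemma pointI:
  assumes "x \<in> A" "\<And>F. F \<in> local_facets \<Longrightarrow> 0 \<le> h F x" "\<And>G. G \<in> far_facets \<Longrightarrow> 0 \<le> h G x"
  shows "x \<in> L"
  using assms facets_cases by (auto simp: points_eq)

text \<open>The facets at \<open>v\<close> meet only in \<open>v\<close>: the reflection of \<open>x\<close> in
  \<open>v\<close> also has nonnegative heights, so the bound \<open>1\<close> for its heights forces
  \<open>x\<close> to have the same heights as \<open>v\<close>.\<close>

lemma local_heights_zero:
  assumes x: "x \<in> L" and 0: "\<And>F. F \<in> local_facets \<Longrightarrow> h F x = 0"
  shows "x = v"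
proof -
  have vA: "v \<in> A" and xA: "x \<in> A" using origin x by (auto intro: point_affine)
  have refl: "h F (v + (v - x)) = 2 * h F v - h F x" if "F \<in> \<Phi>" for F
    using height_affine[OF that vA vA xA] by simp
  have "v + (v - x) \<in> L"
  proof (rule pointI)
    show "v + (v - x) \<in> A" using vA vA xA by (rule affine_closed)
    show "0 \<le> h F (v + (v - x))" if "F \<in> local_facets" for F
      using that 0 refl by (auto simp: local_facets_def)
    show "0 \<le> h G (v + (v - x))" if "G \<in> far_facets" for G
      using that refl[of G] height_le_1[OF x, of G] by (auto simp: far_facets_def)
  qed
  then have "h G x = 1" if "G \<in> far_facets" for G
    using that refl[of G] height_le_1[of "v + (v - x)" G] height_le_1[OF x, of G]
    by (auto simp: far_facets_def)
  then have "h F x = h F v" if "F \<in> \<Phi>" for F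
    using that height_cases[OF origin that] 0[of F] by (auto simp: local_facets_def far_facets_def)
  then show ?thesis using heights_inj[OF x origin] by blast
qed

text \<open>Let \<open>z\<close> be the combination of axis points with the local heights of \<open>x\<close>. Then
  \<open>v + (x - z)\<close> has local heights \<open>0\<close> and nonnegative far heights, so it is a
  lattice point and equals \<open>v\<close>; hence \<open>x = z\<close>.\<close>

lemma far_height:
  assumes x: "x \<in> L" and G: "G \<in> far_facets"
  shows "h G x = 1 - int (card (support x \<inter> clique G))"
proof -
  \<comment> \<open>The point with the local heights of \<open>x\<close>; the proof shows that it is \<open>x\<close>.\<close>
  define z where "z = v + displacement (support x)"
  define d where "d = x + (v - z)"
  have vA: "v \<in> A" and xA: "x \<in> A" using origin x by (auto intro: point_affine)
  note z = displacement_height[OF vA support_subset[of x], folded z_def]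
  have hd: "h F d = h F x + (h F v - h F z)" if "F \<in> \<Phi>" for F
    unfolding d_def using that xA vA z(1) by (rule height_affine)
  have zloc: "h F z = h F x" if "F \<in> local_facets" for F
    using z(3)[OF that] that height_cases[OF x, of F]
    by (auto simp: support_def local_facets_def)
  have zfar: "h G z = 1 - int (card (support x \<inter> clique G))" if "G \<in> far_facets" for G
    using z(5)[OF that] that by (auto simp: far_facets_def)
  have dloc: "h F d = 0" if "F \<in> local_facets" for F
    using that hd[of F] zloc by (auto simp: local_facets_def)
  have "d \<in> L"
  proof (rule pointI)
    show "d \<in> A" unfolding d_def using xA vA z(1) by (rule affine_closed)
    show "0 \<le> h F d" if "F \<in> local_facets" for F using dloc that by simp
    show "0 \<le> h G d" if "G \<in> far_facets" for G
    proof -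
      have "0 \<le> h G x" using x that by (auto simp: points_eq far_facets_def)
      then show ?thesis using that hd[of G] zfar[OF that] by (auto simp: far_facets_def)
    qed
  qed
  then have "d = v" using local_heights_zero dloc by blast
  then show ?thesis using hd[of G] G zfar[OF G] by (auto simp: far_facets_def)
qed

lemma support_clique_le_1:
  assumes "x \<in> L" "G \<in> far_facets"
  shows "card (support x \<inter> clique G) \<le> 1"
  using far_height[OF assms] assms by (auto simp: points_eq far_facets_def)

text \<open>Otherwise the axis could be followed beyond \<open>y F\<close> to a lattice point with height
  \<open>2\<close> over \<open>F\<close>.\<close>

lemma clique_exists:
  assumes F: "F \<in> local_facets"
  shows "\<exists>G\<in>far_facets. F \<in> clique G"
proof (rule ccontr)
  assume no: "\<not> ?thesis"
  have yL: "y F \<in> L" using F axis by (auto simp: local_facets_def)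
  have sub: "{F} \<subseteq> local_facets" using F by simp
  note t = displacement_height[OF point_affine[OF yL] sub]
  have nonneg: "0 \<le> h F' (y F)" if "F' \<in> \<Phi>" for F' using yL that by (auto simp: points_eq)
  have "y F + displacement {F} \<in> L"
  proof (rule pointI)
    show "y F + displacement {F} \<in> A" by (rule t(1))
    show "0 \<le> h F' (y F + displacement {F})" if "F' \<in> local_facets" for F'
      using that t(3)[OF that] nonneg[of F'] by (auto simp: local_facets_def)
    show "0 \<le> h G (y F + displacement {F})" if "G \<in> far_facets" for G
      using that t(5)[OF that] nonneg[of G] no by (auto simp: far_facets_def)
  qed
  then have "h F (y F + displacement {F}) \<le> 1" using F height_le_1 by (auto simp: local_facets_def)
  then show False using t(3)[OF F] axis_off[of F] F by (auto simp: local_facets_def)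
qed

text \<open>The axis point \<open>y F\<close> lies on two far facets \<open>G\<close> and \<open>G'\<close> and on all
  local facets except \<open>F\<close>. A point that leaves only \<open>G\<close> is supported on
  \<open>F\<close>; but \<open>G\<close> and \<open>G'\<close> treat the coordinate \<open>F\<close> alike,
  so it leaves \<open>G'\<close> as well.\<close>

lemma branching_not_simple:
  assumes F: "F \<in> branching"
  shows "\<not> simple_point (y F)"
proof
  assume simple_point: "simple_point (y F)"
  from F obtain G G' where G: "G \<in> far_facets" "G' \<in> far_facets" "G \<noteq> G'" "F \<in> clique G" "F \<in> clique G'"
    and F': "F \<in> local_facets" by (auto simp: branching_def)
  have "G \<in> \<Phi>" "h G (y F) = 0" using G by (auto simp: far_facets_def clique_def)
  with simple_point obtain z where z: "z \<in> L" "h G z = 1"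
    "\<And>F'. F' \<in> \<Phi> - {G} \<Longrightarrow> h F' (y F) = 0 \<Longrightarrow> h F' z = 0"
    unfolding simple_point_def by metis
  have "h F'' z = 0" if "F'' \<in> local_facets" "F'' \<noteq> F" for F''
  proof (rule z(3))
    show "F'' \<in> \<Phi> - {G}" using that G by (auto simp: local_facets_def far_facets_def)
    show "h F'' (y F) = 0" using that F' axis_on by (auto simp: local_facets_def)
  qed
  then have S: "support z \<subseteq> {F}" by (auto simp: support_def) (metis zero_neq_one)
  have "h G' z = 0" using z(3)[of G'] G by (auto simp: far_facets_def clique_def)
  moreover have "support z \<inter> clique G = support z \<inter> clique G'" using S G by auto
  ultimately show False using far_height[OF z(1)] G z(2) by force
qed

text \<open>The face that is cut out by \<open>G\<close> and the local facets other than \<open>W\<close> and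
  \<open>F\<close> contains exactly the lattice points with one nonzero coordinate, which is
  \<open>W\<close> or \<open>F\<close>.\<close>

lemma axis_adjacent:
  assumes "G \<in> far_facets" "W \<in> clique G" "F \<in> clique G" "W \<noteq> F"
  shows "adjacent (y W) (y F)"
  unfolding adjacent_def
proof (intro conjI ballI impI)
  have WF: "W \<in> local_facets" "F \<in> local_facets" using assms by (auto simp: clique_def)
  show yL: "y W \<in> L" "y F \<in> L" using WF axis by (auto simp: local_facets_def)
  show "y W \<noteq> y F" using axis_off[of W] axis_on[of F W] WF assms by (auto simp: local_facets_def)
  fix c assume c: "c \<in> L" and agree: "\<forall>F'\<in>\<Phi>. h F' (y W) = h F' (y F) \<longrightarrow> h F' c = h F' (y W)"
  have "h F' c = 0" if "F' \<in> local_facets" "F' \<noteq> W" "F' \<noteq> F" for F'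
    using agree axis_on[of W F'] axis_on[of F F'] that WF by (auto simp: local_facets_def)
  then have S: "support c \<subseteq> {W, F}" by (auto simp: support_def) (metis zero_neq_one)
  have "h G c = 0" using agree assms by (auto simp: far_facets_def clique_def)
  then have card1: "card (support c \<inter> clique G) = 1" using far_height[OF c assms(1)] by simp
  have SG: "support c \<inter> clique G = support c" using S assms by auto
  have supp_axis: "support (y F) = {F}" if "F \<in> local_facets" for F
    using that axis_off axis_on[of F] by (force simp: support_def local_facets_def)
  have eqI: "c = y F'" if "support c = {F'}" "F' \<in> local_facets" for F'
  proof (rule heights_inj[OF c])
    show "y F' \<in> L" using that axis by (auto simp: local_facets_def)
    have eq: "support c = support (y F')" using supp_axis that by simp
    show "h F'' c = h F'' (y F')" if "F'' \<in> \<Phi>" for F''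
    proof (cases "F'' \<in> far_facets")
      case True
      then show ?thesis using far_height[OF c] far_height[OF \<open>y F' \<in> L\<close>] eq by simp
    next
      case False
      then have "F'' \<in> local_facets" using that facets_cases by auto
      then have "h F'' c = 1 \<longleftrightarrow> h F'' (y F') = 1" using eq unfolding support_def by blast
      then show ?thesis
        using height_cases[OF c that] height_cases[OF \<open>y F' \<in> L\<close> that] by auto
    qed
  qed
  obtain z where "support c = {z}" using card1 SG by (metis card_1_singletonE)
  with S have "support c = {W} \<or> support c = {F}" by auto
  then show "c = y W \<or> c = y F" using eqI WF by blast
qed


text \<open>One exchange that brings the member \<open>x\<close> closer to \<open>v\<close>. The positivity assumption
  says that no far facet contains all members; it provides an exchange partner \<open>c\<close>. Progress is
  measured first by the number of branching axes in the support and then by its size, because removing a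
  branching axis may enlarge the support by other axes.\<close>

lemma exchange_step:
  assumes simple_point: "\<And>a b. adjacent a b \<Longrightarrow> simple_point a \<or> simple_point b"
    and x: "x \<in> L" "x \<noteq> v" and C: "set_mset C \<subseteq> L"
    and pos: "\<And>G. G \<in> far_facets \<Longrightarrow> \<exists>c\<in>#add_mset x C. h G c = 1"
  obtains x' c c' where "x' \<in> L" "c' \<in> L" "c \<in># C" "x + c = x' + c'"
    "(x', x) \<in> measures [\<lambda>x. card (support x \<inter> branching), \<lambda>x. card (support x)]"
proof (cases "support x \<inter> branching = {}")
  case True
  have "support x \<noteq> {}"
    using local_heights_zero[OF x(1)] x(2) height_cases[OF x(1)]
    by (auto simp: support_def local_facets_def)
  \<comment> \<open>No branching axis is left: move one axis \<open>F\<close> from \<open>x\<close> to a member that avoids its unique clique.\<close>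
  then obtain F where F: "F \<in> support x" by auto
  then have Fl: "F \<in> local_facets" by (auto simp: support_def)
  obtain G where G: "G \<in> far_facets" "F \<in> clique G" using clique_exists[OF Fl] by auto
  have uniq: "G' = G" if "G' \<in> far_facets" "F \<in> clique G'" for G'
    using that G F True Fl by (auto simp: branching_def)
  have hit: "h G' x = 0" if "G' \<in> far_facets" "F \<in> clique G'" for G'
  proof -
    have "F \<in> support x \<inter> clique G'" using F that by auto
    then have "card (support x \<inter> clique G') \<noteq> 0" by auto
    then show ?thesis
      using far_height[OF x(1) that(1)] support_clique_le_1[OF x(1) that(1)] by linarith
  qed
  obtain c where c: "c \<in># add_mset x C" "h G c = 1" using pos[OF G(1)] by blast
  with hit[OF G] have cC: "c \<in># C" by auto
  then have cL: "c \<in> L" using C by auto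
  have "card (support c \<inter> clique G) = 0" using far_height[OF cL G(1)] c(2) by simp
  then have Fc: "F \<notin> support c" using G(2) by auto
  then have hFc: "h F c = 0" using Fl height_cases[OF cL, of F] by (auto simp: support_def local_facets_def)
  have sub: "{F} \<subseteq> local_facets" using Fl by simp
  define x' c' where "x' = x - displacement {F}" and "c' = c + displacement {F}"
  note dx = displacement_height[OF point_affine[OF x(1)] sub, folded x'_def]
  note dc = displacement_height[OF point_affine[OF cL] sub, folded c'_def]
  have nonneg: "0 \<le> h F' z" if "F' \<in> local_facets \<union> far_facets" "z \<in> L" for F' z
    using that facets_cases by (auto simp: points_eq)
  have hFx: "h F x = 1" using F by (auto simp: support_def)
  have x'L: "x' \<in> L"
  proof (rule pointI)
    show "x' \<in> A" by (rule dx(2))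
    show "0 \<le> h F' x'" if "F' \<in> local_facets" for F'
      using that dx(4)[OF that] hFx nonneg[of F' x] x(1) by auto
    show "0 \<le> h G' x'" if "G' \<in> far_facets" for G'
      using that dx(6)[OF that] nonneg[of G' x] x(1) by auto
  qed
  have c'L: "c' \<in> L"
  proof (rule pointI)
    show "c' \<in> A" by (rule dc(1))
    show "0 \<le> h F' c'" if "F' \<in> local_facets" for F'
      using that dc(3)[OF that] nonneg[of F' c] cL by auto
    show "0 \<le> h G' c'" if "G' \<in> far_facets" for G'
    proof (cases "F \<in> clique G'")
      case True
      then show ?thesis using uniq[OF that] dc(5)[OF that] c(2) by simp
    next
      case False
      then show ?thesis using dc(5)[OF that] nonneg[of G' c] that cL by simp
    qed
  qed
  have "support x' = support x - {F}"
    using dx(4) hFx by (auto simp: support_def split: if_splits)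
  then have "support x' \<inter> branching = support x \<inter> branching"
    and "card (support x') < card (support x)"
    using True card_Diff1_less[OF finite_local(3) F] by auto
  then show thesis using that[OF x'L c'L cC] by (simp add: x'_def c'_def)
next
  case False
  \<comment> \<open>Swap the branching axis \<open>W\<close> of \<open>x\<close> with the set \<open>N\<close> of its neighbours in a member \<open>c\<close>.\<close>
  then obtain W where W: "W \<in> support x" "W \<in> branching" by auto
  then have Wl: "W \<in> local_facets" by (auto simp: support_def)
  obtain G where G: "G \<in> far_facets" "W \<in> clique G" using clique_exists[OF Wl] by auto
  have hit: "h G' x = 0" if "G' \<in> far_facets" "W \<in> clique G'" for G'
  proof -
    have "W \<in> support x \<inter> clique G'" using W that by auto
    then have "card (support x \<inter> clique G') \<noteq> 0" by auto
    then show ?thesis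
      using far_height[OF x(1) that(1)] support_clique_le_1[OF x(1) that(1)] by linarith
  qed
  obtain c where c: "c \<in># add_mset x C" "h G c = 1" using pos[OF G(1)] by blast
  with hit[OF G] have cC: "c \<in># C" by auto
  then have cL: "c \<in> L" using C by auto
  have "card (support c \<inter> clique G) = 0" using far_height[OF cL G(1)] c(2) by simp
  then have Wc: "W \<notin> support c" using G(2) by auto
  define N where "N = {F \<in> support c. \<exists>G'\<in>far_facets. W \<in> clique G' \<and> F \<in> clique G'}"
  have NS: "N \<subseteq> support c" by (auto simp: N_def)
  have Nl: "N \<subseteq> local_facets" using NS support_subset by blast
  have WN: "W \<notin> N" using Wc NS by auto
  have Nb: "F \<notin> branching" if FN: "F \<in> N" for F
  proof
    assume "F \<in> branching"
    moreover obtain G' where "G' \<in> far_facets" "W \<in> clique G'" "F \<in> clique G'"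
      using FN by (auto simp: N_def)
    ultimately show False
      using simple_point[OF axis_adjacent] branching_not_simple W(2) WN FN by metis
  qed
  have sub: "{W} \<subseteq> local_facets" using Wl by simp
  define x1 c1 where "x1 = x - displacement {W}" and "c1 = c + displacement {W}"
  note dx1 = displacement_height[OF point_affine[OF x(1)] sub, folded x1_def]
  note dc1 = displacement_height[OF point_affine[OF cL] sub, folded c1_def]
  define x' c' where "x' = x1 + displacement N" and "c' = c1 - displacement N"
  note dx = displacement_height[OF dx1(2) Nl, folded x'_def]
  note dc = displacement_height[OF dc1(1) Nl, folded c'_def]
  have nonneg: "0 \<le> h F' z" if "F' \<in> local_facets \<union> far_facets" "z \<in> L" for F' z
    using that facets_cases by (auto simp: points_eq)
  have hWx: "h W x = 1" using W by (auto simp: support_def)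
  have hNc: "h F c = 1" if "F \<in> N" for F using that NS by (auto simp: support_def)
  have x'L: "x' \<in> L"
  proof (rule pointI)
    show "x' \<in> A" by (rule dx(1))
    show "0 \<le> h F' x'" if "F' \<in> local_facets" for F'
      using that dx(3)[OF that] dx1(4)[OF that] hWx nonneg[of F' x] x(1) by auto
    show "0 \<le> h G' x'" if G': "G' \<in> far_facets" for G'
    proof (cases "W \<in> clique G'")
      case True
      have "card (N \<inter> clique G') \<le> card (support c \<inter> clique G')"
        using NS by (intro card_mono) auto
      also have "\<dots> \<le> 1" by (rule support_clique_le_1[OF cL G'])
      finally show ?thesis using dx(5)[OF G'] dx1(6)[OF G'] hit[OF G' True] True by simp
    next
      case False
      \<comment> \<open>A neighbour of \<open>W\<close> in a clique without \<open>W\<close> would lie in two cliques and be branching.\<close>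
      have "N \<inter> clique G' = {}"
      proof (rule ccontr)
        assume "N \<inter> clique G' \<noteq> {}"
        then obtain F G'' where F: "F \<in> N" "F \<in> clique G'"
          and G'': "G'' \<in> far_facets" "W \<in> clique G''" "F \<in> clique G''"
          by (auto simp: N_def)
        have "G' \<noteq> G''" "F \<in> local_facets" using False G''(2) F(1) Nl by auto
        then have "F \<in> branching" unfolding branching_def using G' G'' F(2) by blast
        then show False using Nb[OF F(1)] by simp
      qed
      then show ?thesis using dx(5)[OF G'] dx1(6)[OF G'] False nonneg[of G' x] G' x(1) by simp
    qed
  qed
  have c'L: "c' \<in> L"
  proof (rule pointI)
    show "c' \<in> A" by (rule dc(2))
    show "0 \<le> h F' c'" if "F' \<in> local_facets" for F'
      using that dc(4)[OF that] dc1(3)[OF that] hNc[of F'] WN nonneg[of F' c] cL by auto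
    show "0 \<le> h G' c'" if G': "G' \<in> far_facets" for G'
    proof (cases "W \<in> clique G'")
      case True
      have "N \<inter> clique G' = support c \<inter> clique G'" using True G' by (auto simp: N_def)
      then show ?thesis using dc(6)[OF G'] dc1(5)[OF G'] True far_height[OF cL G'] by simp
    next
      case False
      then show ?thesis using dc(6)[OF G'] dc1(5)[OF G'] nonneg[of G' c] G' cL by simp
    qed
  qed
  have "support x' \<subseteq> (support x - {W}) \<union> N"
    using dx(3) dx1(4) hWx WN by (auto simp: support_def split: if_splits)
  then have "support x' \<inter> branching \<subseteq> (support x \<inter> branching) - {W}" using Nb by blast
  then have "card (support x' \<inter> branching) \<le> card ((support x \<inter> branching) - {W})"
    by (intro card_mono) auto
  also have "\<dots> < card (support x \<inter> branching)" using W by (intro card_Diff1_less) auto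
  finally show thesis using that[OF x'L c'L cC] by (simp add: x'_def c'_def x1_def c1_def)
qed

lemma exchange_reaches_origin:
  assumes simple_point: "\<And>a b. adjacent a b \<Longrightarrow> simple_point a \<or> simple_point b"
  shows "\<lbrakk>x \<in> L; set_mset C \<subseteq> L; \<And>G. G \<in> far_facets \<Longrightarrow> \<exists>c\<in>#add_mset x C. h G c = 1\<rbrakk>
    \<Longrightarrow> \<exists>D. set_mset D \<subseteq> L \<and> exchange_equiv L (add_mset x C) (add_mset v D)"
proof (induction x arbitrary: C
    rule: wf_induct_rule[OF wf_measures[of "[\<lambda>x. card (support x \<inter> branching), \<lambda>x. card (support x)]"]])
  case (1 x)
  show ?case
  proof (cases "x = v")
    case True
    then show ?thesis using 1 exchange_equiv.refl by blast
  next
    case False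
    obtain x' c c' where s: "x' \<in> L" "c' \<in> L" "c \<in># C" "x + c = x' + c'"
      "(x', x) \<in> measures [\<lambda>x. card (support x \<inter> branching), \<lambda>x. card (support x)]"
      using exchange_step[OF simple_point 1(2) False 1(3,4)] by blast
    obtain C' where C': "C = add_mset c C'" using s(3) by (metis insert_DiffM)
    have cL: "c \<in> L" and C'L: "set_mset C' \<subseteq> L" using 1(3) C' by auto
    have eq: "exchange_equiv L (add_mset x C) (add_mset x' (add_mset c' C'))"
      using exchange_equiv.add[OF exchange_equiv.exchange[OF 1(2) cL s(1,2,4)] C'L]
      by (simp add: C')
    have "\<exists>D. set_mset D \<subseteq> L \<and> exchange_equiv L (add_mset x' (add_mset c' C')) (add_mset v D)"
    proof (rule 1(1)[OF s(5,1)])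
      show "set_mset (add_mset c' C') \<subseteq> L" using s(2) C'L by simp
      fix G assume G: "G \<in> far_facets"
      then have G\<Phi>: "G \<in> \<Phi>" by (auto simp: far_facets_def)
      obtain d where d: "d \<in># add_mset x C" "h G d = 1" using 1(4)[OF G] by blast
      have "x' = x + (c - c')" using s(4) by (simp add: algebra_simps)
      then have sum: "h G x' + h G c' = h G x + h G c"
        using height_affine[OF G\<Phi> point_affine[OF 1(2)] point_affine[OF cL] point_affine[OF s(2)]] by simp
      have "d \<in># C' \<or> h G x' = 1 \<or> h G c' = 1"
        using d sum height_cases[OF 1(2) G\<Phi>] height_cases[OF cL G\<Phi>]
          height_cases[OF s(1) G\<Phi>] height_cases[OF s(2) G\<Phi>] C' by auto
      then show "\<exists>c\<in>#add_mset x' (add_mset c' C'). h G c = 1" using d by auto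
    qed
    then show ?thesis using exchange_equiv.trans[OF eq] by blast
  qed
qed

end

context facet_system
begin

text \<open>Affine functions on \<open>A\<close> need not extend to the group, so sums of members are compared after
  translation by a base point \<open>b\<close> of \<open>A\<close>.\<close>

lemma height_sum_mset:
  assumes F: "F \<in> \<Phi>" and "set_mset M \<subseteq> L" "set_mset N \<subseteq> L" "size M = size N" "sum_mset M = sum_mset N"
  shows "(\<Sum>x\<in>#M. h F x) = (\<Sum>x\<in>#N. h F x)"
proof (cases "M = {#}")
  case True
  then show ?thesis using assms by simp
next
  case False
  then obtain b where b: "b \<in> A" using assms(2) point_affine by (metis multiset_nonemptyE subset_iff)
  have *: "b + (\<Sum>x\<in>#K. x - b) \<in> A \<and> h F (b + (\<Sum>x\<in>#K. x - b)) = h F b + (\<Sum>x\<in>#K. h F x) - int (size K) * h F b"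
    if "set_mset K \<subseteq> L" for K
    using that
  proof (induction K)
    case (add x K)
    let ?z = "b + (\<Sum>x\<in>#K. x - b)"
    have z: "?z \<in> A" "h F ?z = h F b + (\<Sum>x\<in>#K. h F x) - int (size K) * h F b" and x: "x \<in> A"
      using add point_affine by auto
    have e: "b + (\<Sum>x\<in>#add_mset x K. x - b) = ?z + (x - b)" by (simp add: algebra_simps)
    show ?case unfolding e using affine_closed[OF z(1) x b] height_affine[OF F z(1) x b] z(2)
      by (simp add: algebra_simps)
  qed (use b in simp)
  have diff: "((\<Sum>x\<in>#K. x - b)) = sum_mset K - (\<Sum>x\<in>#K. b)" for K
    by (induction K) (auto simp: algebra_simps)
  have const: "(\<Sum>x\<in>#M. b) = (\<Sum>x\<in>#N. b)"
    using assms(4) by (simp add: image_mset_const_eq)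
  have "(\<Sum>x\<in>#M. x - b) = (\<Sum>x\<in>#N. x - b)" unfolding diff const assms(5) ..
  then show ?thesis using *[OF assms(2)] *[OF assms(3)] assms(4) by simp
qed

text \<open>The second assumption holds for the lattice points \<open>Q\<close> of any face. Two distinct points
  \<open>a\<close> and \<open>b\<close> of \<open>Q\<close> whose heights differ on as few facets as
  possible are adjacent: any further point of their smallest face would agree with \<open>a\<close> on more
  facets than \<open>b\<close> does.\<close>

lemma adjacent_pair_exists:
  assumes Q: "Q \<subseteq> L" "\<And>c a b. \<lbrakk>c \<in> L; a \<in> Q; b \<in> Q; \<forall>F\<in>\<Phi>. h F a = h F b \<longrightarrow> h F c = h F a\<rbrakk> \<Longrightarrow> c \<in> Q"
    and "p \<in> Q" "q \<in> Q" "p \<noteq> q"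
  shows "\<exists>a\<in>Q. \<exists>b\<in>Q. adjacent a b"
proof -
  define D where "D a b = {F \<in> \<Phi>. h F a \<noteq> h F b}" for a b
  obtain a b where ab: "a \<in> Q" "b \<in> Q" "a \<noteq> b"
    and min: "\<And>a' b'. a' \<in> Q \<Longrightarrow> b' \<in> Q \<Longrightarrow> a' \<noteq> b' \<Longrightarrow> card (D a b) \<le> card (D a' b')"
  proof -
    define R where "R = (\<lambda>z. fst z \<in> Q \<and> snd z \<in> Q \<and> fst z \<noteq> snd z)"
    have "R (p, q)" using assms by (simp add: R_def)
    then have "\<exists>z. R z \<and> (\<forall>w. R w \<longrightarrow> card (D (fst z) (snd z)) \<le> card (D (fst w) (snd w)))"
      by (rule ex_has_least_nat)
    then obtain z where "R z" "\<And>w. R w \<Longrightarrow> card (D (fst z) (snd z)) \<le> card (D (fst w) (snd w))" by blast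
    then show ?thesis using that[of "fst z" "snd z"] unfolding R_def by force
  qed
  have "adjacent a b"
    unfolding adjacent_def
  proof (intro conjI ballI impI)
    show "a \<in> L" "b \<in> L" "a \<noteq> b" using ab Q by auto
    fix c assume c: "c \<in> L" "\<forall>F\<in>\<Phi>. h F a = h F b \<longrightarrow> h F c = h F a"
    show "c = a \<or> c = b"
    proof (rule ccontr)
      assume n: "\<not> ?thesis"
      have "c \<in> Q" using Q(2)[OF c(1) ab(1,2) c(2)] .
      then have le: "card (D a b) \<le> card (D a c)" using min[of a c] ab n by auto
      have "D a c \<subseteq> D a b" using c(2) by (auto simp: D_def)
      moreover have "finite (D a b)" using finite_facets by (simp add: D_def)
      ultimately have "D a c = D a b" using le by (simp add: card_seteq)
      then have "h F c = h F b" if "F \<in> \<Phi>" for F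
      proof -
        have "a \<in> L" "b \<in> L" using ab Q(1) by auto
        moreover have "h F a \<noteq> h F c \<longleftrightarrow> h F a \<noteq> h F b"
          using \<open>D a c = D a b\<close> that unfolding D_def by blast
        ultimately show ?thesis
          using height_cases[of a F] height_cases[of b F] height_cases[of c F] c(1) that by auto
      qed
      then have "c = b" using heights_inj[OF c(1)] ab Q(1) by blast
      then show False using n by blast
    qed
  qed
  then show ?thesis using ab by blast
qed

text \<open>The size and the sum determine the total heights and hence the smallest face that contains the members.
  Unless this face is a single point, it has a simple point; both multisets can be made to contain this
  point, and the induction hypothesis applies to the rest.\<close>

theorem exchange_equiv_fibre:
  assumes simple_point: "\<And>a b. adjacent a b \<Longrightarrow> simple_point a \<or> simple_point b"
  shows "\<lbrakk>set_mset M \<subseteq> L; set_mset N \<subseteq> L; size M = size N; sum_mset M = sum_mset N\<rbrakk>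
    \<Longrightarrow> exchange_equiv L M N"
proof (induction "size M" arbitrary: M N)
  case 0
  then show ?case using exchange_equiv.refl by auto
next
  case (Suc n)
  \<comment> \<open>The lattice points of the smallest face that contains all members of \<open>M\<close>.\<close>
  define Q where "Q = {x \<in> L. \<forall>F\<in>\<Phi>. (\<Sum>c\<in>#M. h F c) = 0 \<longrightarrow> h F x = 0}"
  have sums: "(\<Sum>c\<in>#M. h F c) = (\<Sum>c\<in>#N. h F c)" if "F \<in> \<Phi>" for F
    using height_sum_mset that Suc by blast
  have zero: "h F x = 0" if "F \<in> \<Phi>" "set_mset K \<subseteq> L" "x \<in># K" "(\<Sum>c\<in>#K. h F c) = 0" for F x K
  proof -
    have "\<forall>c\<in>#K. 0 \<le> h F c" using that by (auto simp: points_eq)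
    then have "\<And>c. c \<in># K - {#x#} \<Longrightarrow> 0 \<le> h F c" by (auto dest: in_diffD)
    then have "(0::int) \<le> (\<Sum>c\<in>#K - {#x#}. h F c)"
      using sum_mset_mono[of "K - {#x#}" "\<lambda>_. 0" "h F"] by simp
    moreover have "(\<Sum>c\<in>#K. h F c) = h F x + (\<Sum>c\<in>#K - {#x#}. h F c)"
      using that(3) by (metis image_mset_add_mset insert_DiffM sum_mset.insert)
    moreover have "0 \<le> h F x" using that by (auto simp: points_eq)
    ultimately show ?thesis using that(4) by linarith
  qed
  have MQ: "set_mset M \<subseteq> Q" using zero[OF _ Suc(3)] Suc(3) by (auto simp: Q_def)
  have NQ: "set_mset N \<subseteq> Q" using zero[OF _ Suc(4)] Suc(4) sums by (auto simp: Q_def)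
  show ?case
  proof (cases "\<exists>p\<in>Q. \<exists>q\<in>Q. p \<noteq> q")
    case False
    obtain p where p: "p \<in># M" using Suc(2) by (metis multiset_nonemptyE nat.distinct(1) size_empty)
    then have "\<forall>q\<in>Q. q = p" using False MQ by blast
    then have "M = replicate_mset (size M) p" "N = replicate_mset (size N) p"
      using MQ NQ by (auto intro!: set_mset_subset_singletonD)
    then show ?thesis using Suc(5) exchange_equiv.refl by metis
  next
    case True
    then obtain p q where pq: "p \<in> Q" "q \<in> Q" "p \<noteq> q" by blast
    have "Q \<subseteq> L" by (auto simp: Q_def)
    moreover have "c \<in> Q" if "c \<in> L" "a \<in> Q" "b \<in> Q" "\<forall>F\<in>\<Phi>. h F a = h F b \<longrightarrow> h F c = h F a" for a b c
      using that by (auto simp: Q_def)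
    ultimately obtain v where v: "v \<in> Q" "simple_point v"
      using adjacent_pair_exists[of Q p q] pq simple_point by blast
    from v(2) have "\<forall>F. \<exists>y. F \<in> \<Phi> \<longrightarrow> h F v = 0 \<longrightarrow>
        y \<in> L \<and> h F y = 1 \<and> (\<forall>F'\<in>\<Phi> - {F}. h F' v = 0 \<longrightarrow> h F' y = 0)"
      unfolding simple_point_def by blast
    then obtain y where y: "\<And>F. F \<in> \<Phi> \<Longrightarrow> h F v = 0 \<Longrightarrow>
        y F \<in> L \<and> h F (y F) = 1 \<and> (\<forall>F'\<in>\<Phi> - {F}. h F' v = 0 \<longrightarrow> h F' (y F) = 0)"
      by metis
    \<comment> \<open>All far facets of this chart have positive total height on the multisets, because \<open>v\<close> lies in \<open>Q\<close>.\<close>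
    interpret facet_chart A \<Phi> h L v y
      by unfold_locales (use v y in \<open>auto simp: Q_def\<close>)
    have reach: "\<exists>D. set_mset D \<subseteq> L \<and> exchange_equiv L K (add_mset v D)"
      if K: "set_mset K \<subseteq> L" "size K = size M" "\<And>F. F \<in> \<Phi> \<Longrightarrow> (\<Sum>c\<in>#K. h F c) = (\<Sum>c\<in>#M. h F c)" for K
    proof -
      obtain x where x: "x \<in># K" using K(2) Suc(2) by (metis multiset_nonemptyE nat.distinct(1) size_empty)
      obtain C where C: "K = add_mset x C" using x by (metis insert_DiffM)
      have "\<exists>c\<in>#K. h G c = 1" if "G \<in> far_facets" for G
      proof (rule ccontr)
        assume n: "\<not> ?thesis"
        have G: "G \<in> \<Phi>" "h G v = 1" using that by (auto simp: far_facets_def)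
        have "\<And>c. c \<in># K \<Longrightarrow> h G c = 0" using n K(1) height_cases[OF _ G(1)] by blast
        then have "image_mset (h G) K = image_mset (\<lambda>_. 0) K" by (rule image_mset_cong)
        then have "(\<Sum>c\<in>#K. h G c) = 0" by simp
        then have "h G v = 0" using K(3)[OF G(1)] v(1) G(1) by (auto simp: Q_def)
        then show False using G(2) by simp
      qed
      then show ?thesis using exchange_reaches_origin[OF simple_point, of x C] K(1) C by auto
    qed
    obtain M' where M': "set_mset M' \<subseteq> L" "exchange_equiv L M (add_mset v M')"
      using reach[of M] Suc(3) by blast
    obtain N' where N': "set_mset N' \<subseteq> L" "exchange_equiv L N (add_mset v N')"
      using reach[of N] Suc(4,5) sums by auto
    have sz: "Suc (size M') = size M" "Suc (size N') = size N"
      using exchange_equiv_size[OF M'(2)] exchange_equiv_size[OF N'(2)] by auto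
    have "v + sum_mset M' = v + sum_mset N'"
      using exchange_equiv_sum_mset[OF M'(2)] exchange_equiv_sum_mset[OF N'(2)] Suc(6) by simp
    then have "sum_mset M' = sum_mset N'" by simp
    then have "exchange_equiv L M' N'" using Suc(1)[of M' N'] Suc(2,5) sz M'(1) N'(1) by simp
    then have "exchange_equiv L (add_mset v M') (add_mset v N')"
      using exchange_equiv.add[of L M' N' "{#v#}"] origin by simp
    then show ?thesis
      using M'(2) N'(2) exchange_equiv.trans exchange_equiv.sym by blast
  qed
qed

end

section \<open>Binomials and ideals of quadrics\<close>

lemma poly_mapping_sum_single:
  fixes p :: "'a \<Rightarrow>\<^sub>0 'b::comm_monoid_add"
  assumes "finite K" "Poly_Mapping.keys p \<subseteq> K"
  shows "(\<Sum>e\<in>K. Poly_Mapping.single e (Poly_Mapping.lookup p e)) = p"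
proof (rule poly_mapping_eqI)
  fix k
  have "(\<Sum>e\<in>K. Poly_Mapping.lookup (Poly_Mapping.single e (Poly_Mapping.lookup p e)) k)
      = (\<Sum>e\<in>K. if e = k then Poly_Mapping.lookup p k else 0)"
    by (intro sum.cong) (auto simp: lookup_single)
  also have "\<dots> = Poly_Mapping.lookup p k"
    using assms by (auto simp: not_in_keys_iff_lookup_eq_zero[symmetric])
  finally show "Poly_Mapping.lookup (\<Sum>e\<in>K. Poly_Mapping.single e (Poly_Mapping.lookup p e)) k
      = Poly_Mapping.lookup p k"
    by (simp add: lookup_sum)
qed

text \<open>The element of the semigroup to which the monomial with exponent \<open>e\<close> is sent.\<close>

definition toric_degree :: "(real ^ 'n \<Rightarrow>\<^sub>0 nat) \<Rightarrow> (real ^ 'n) \<times> int" where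
  "toric_degree e = (\<Sum>m\<in>Poly_Mapping.keys e.
     (of_nat (Poly_Mapping.lookup e m) *\<^sub>R m, int (Poly_Mapping.lookup e m)))"

lemma toric_degree_superset:
  assumes "finite K" "Poly_Mapping.keys e \<subseteq> K"
  shows "toric_degree e = (\<Sum>m\<in>K. (of_nat (Poly_Mapping.lookup e m) *\<^sub>R m, int (Poly_Mapping.lookup e m)))"
  unfolding toric_degree_def
  by (intro sum.mono_neutral_left assms) (auto simp: in_keys_iff zero_prod_def)

lemma toric_degree_add: "toric_degree (e + e') = toric_degree e + toric_degree e'"
proof -
  let ?K = "Poly_Mapping.keys e \<union> Poly_Mapping.keys e'"
  have "Poly_Mapping.keys (e + e') \<subseteq> ?K" by (rule keys_add)
  then show ?thesis
    by (simp add: toric_degree_superset[of ?K] lookup_add scaleR_add_left flip: sum.distrib)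
qed

lemma toric_degree_0 [simp]: "toric_degree 0 = 0"
  by (simp add: toric_degree_def)

lemma toric_degree_single [simp]: "toric_degree (Poly_Mapping.single x 1) = (x, 1)"
  by (simp add: toric_degree_def)

lemma prod_single:
  fixes f :: "'b \<Rightarrow> 'a::comm_monoid_add"
  shows "finite K \<Longrightarrow> (\<Prod>m\<in>K. Poly_Mapping.single (f m) (1::'c::comm_semiring_1)) = Poly_Mapping.single (sum f K) 1"
  by (induction K rule: finite_induct) (auto simp: mult_single)

lemma single_point_power:
  "Poly_Mapping.single (m :: real ^ 'n, 1 :: int) (1::complex) ^ k = Poly_Mapping.single (of_nat k *\<^sub>R m, int k) 1"
proof (induction k)
  case 0
  have "(0 :: (real ^ 'n) \<times> int) = (of_nat 0 *\<^sub>R m, int 0)" by (simp add: zero_prod_def)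
  then show ?case by (metis power_0 single_one)
next
  case (Suc k)
  then show ?case by (simp add: mult_single scaleR_add_left)
qed

lemma toric_hom_superset:
  assumes "finite K" "Poly_Mapping.keys p \<subseteq> K"
  shows "toric_hom p = (\<Sum>e\<in>K. Poly_Mapping.single (toric_degree e) (Poly_Mapping.lookup p e))"
proof -
  have "toric_hom p = (\<Sum>e\<in>Poly_Mapping.keys p. Poly_Mapping.single (toric_degree e) (Poly_Mapping.lookup p e))"
    unfolding toric_hom_def single_point_power by (simp add: prod_single mult_single toric_degree_def)
  also have "\<dots> = (\<Sum>e\<in>K. Poly_Mapping.single (toric_degree e) (Poly_Mapping.lookup p e))"
    by (intro sum.mono_neutral_left assms) (auto simp: in_keys_iff)
  finally show ?thesis .
qed

lemma toric_hom_add: "toric_hom (p + q) = toric_hom p + toric_hom q"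
proof -
  let ?K = "Poly_Mapping.keys p \<union> Poly_Mapping.keys q"
  have "Poly_Mapping.keys (p + q) \<subseteq> ?K" by (rule keys_add)
  then show ?thesis
    by (simp add: toric_hom_superset[of ?K] lookup_add single_add flip: sum.distrib)
qed

lemma toric_hom_0 [simp]: "toric_hom 0 = 0"
  by (simp add: toric_hom_def)

lemma toric_hom_single [simp]: "toric_hom (Poly_Mapping.single e c) = Poly_Mapping.single (toric_degree e) c"
  by (simp add: toric_hom_superset[of "{e}"])

lemma toric_hom_uminus: "toric_hom (- p) = - toric_hom p"
  using toric_hom_add[of p "- p"] by (simp add: eq_neg_iff_add_eq_0 add.commute)

lemma toric_hom_diff: "toric_hom (p - q) = toric_hom p - toric_hom q"
  using toric_hom_add[of p "- q"] by (simp add: toric_hom_uminus)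

lemma toric_hom_sum: "finite K \<Longrightarrow> toric_hom (sum f K) = (\<Sum>i\<in>K. toric_hom (f i))"
  by (induction K rule: finite_induct) (auto simp: toric_hom_add)

lemma toric_hom_mult: "toric_hom (p * q) = toric_hom p * toric_hom q"
proof -
  have "p * q = (\<Sum>e\<in>Poly_Mapping.keys p. \<Sum>e'\<in>Poly_Mapping.keys q.
      Poly_Mapping.single (e + e') (Poly_Mapping.lookup p e * Poly_Mapping.lookup q e'))"
    by (subst (1) poly_mapping_sum_single[symmetric, of "Poly_Mapping.keys p" p],
        simp, simp, subst (1) poly_mapping_sum_single[symmetric, of "Poly_Mapping.keys q" q],
        simp, simp, simp add: sum_product mult_single)
  also have "toric_hom \<dots> = toric_hom p * toric_hom q"
    by (simp add: toric_hom_sum toric_degree_add toric_hom_superset[of "Poly_Mapping.keys p" p]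
        toric_hom_superset[of "Poly_Mapping.keys q" q] sum_product mult_single)
  finally show ?thesis .
qed

lemma lookup_toric_hom:
  "Poly_Mapping.lookup (toric_hom p) s
    = (\<Sum>e\<in>{e \<in> Poly_Mapping.keys p. toric_degree e = s}. Poly_Mapping.lookup p e)"
  by (simp add: toric_hom_superset[of "Poly_Mapping.keys p"] lookup_sum lookup_single when_def
      sum.inter_filter)

lemma coordinate_ring_simps [simp]:
  "p \<in> carrier (coordinate_ring X) \<longleftrightarrow> (\<forall>e\<in>Poly_Mapping.keys p. Poly_Mapping.keys e \<subseteq> X)"
  "mult (coordinate_ring X) = (*)" "one (coordinate_ring X) = 1"
  "ring.zero (coordinate_ring X) = 0" "ring.add (coordinate_ring X) = (+)"
  by (simp_all add: coordinate_ring_def)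

lemma ring_coordinate_ring: "ring (coordinate_ring X)"
proof (rule ringI)
  show "abelian_group (coordinate_ring X)"
  proof (rule abelian_groupI)
    show "\<And>x y. \<lbrakk>x \<in> carrier (coordinate_ring X); y \<in> carrier (coordinate_ring X)\<rbrakk>
        \<Longrightarrow> x \<oplus>\<^bsub>coordinate_ring X\<^esub> y \<in> carrier (coordinate_ring X)"
      using keys_add by fastforce
    fix x assume "x \<in> carrier (coordinate_ring X)"
    then show "\<exists>y\<in>carrier (coordinate_ring X). y \<oplus>\<^bsub>coordinate_ring X\<^esub> x = \<zero>\<^bsub>coordinate_ring X\<^esub>"
      by (intro bexI[of _ "- x"]) (auto simp: in_keys_iff)
  qed (auto simp: add_ac)
  show "Group.monoid (coordinate_ring X)"
  proof (rule Group.monoidI)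
    fix x y assume x: "x \<in> carrier (coordinate_ring X)" and y: "y \<in> carrier (coordinate_ring X)"
    have "Poly_Mapping.keys e \<subseteq> X" if e: "e \<in> Poly_Mapping.keys (x * y)" for e
    proof -
      obtain a b where ab: "e = a + b" "a \<in> Poly_Mapping.keys x" "b \<in> Poly_Mapping.keys y"
        using e keys_mult[of x y] by blast
      then have "Poly_Mapping.keys a \<subseteq> X" "Poly_Mapping.keys b \<subseteq> X" using x y by simp_all
      then show ?thesis using keys_add[of a b] ab(1) by blast
    qed
    then show "x \<otimes>\<^bsub>coordinate_ring X\<^esub> y \<in> carrier (coordinate_ring X)" by simp
  qed (auto simp: mult_ac)
qed (auto simp: algebra_simps)

lemma toric_ideal_eq:
  "toric_ideal P = {p \<in> carrier (coordinate_ring (lattice_points P)). toric_hom p = 0}"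
  by (simp add: toric_ideal_def a_kernel_def' semigroup_ring_def)

lemma ideal_toric_ideal: "ideal (toric_ideal P) (coordinate_ring (lattice_points P))"
proof -
  let ?R = "coordinate_ring (lattice_points P)"
  interpret R: ring ?R by (rule ring_coordinate_ring)
  show ?thesis
  proof (rule idealI[OF ring_coordinate_ring])
    show "subgroup (toric_ideal P) (add_monoid ?R)"
    proof (rule R.add.subgroupI)
      show "toric_ideal P \<subseteq> carrier ?R" "toric_ideal P \<noteq> {}"
        by (auto simp: toric_ideal_eq intro!: exI[of _ 0])
      fix a assume a: "a \<in> toric_ideal P"
      then have "\<ominus>\<^bsub>?R\<^esub> a = - a"
        by (intro R.minus_equality) (auto simp: toric_ideal_eq in_keys_iff)
      then show "\<ominus>\<^bsub>?R\<^esub> a \<in> toric_ideal P"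
        using a by (auto simp: toric_ideal_eq toric_hom_uminus in_keys_iff)
      fix b assume b: "b \<in> toric_ideal P"
      then show "a \<oplus>\<^bsub>?R\<^esub> b \<in> toric_ideal P"
        using a R.add.m_closed[of a b] by (auto simp: toric_ideal_eq toric_hom_add)
    qed
    fix a x assume "a \<in> toric_ideal P" "x \<in> carrier ?R"
    then show "x \<otimes>\<^bsub>?R\<^esub> a \<in> toric_ideal P" "a \<otimes>\<^bsub>?R\<^esub> x \<in> toric_ideal P"
      using R.m_closed[of x a] R.m_closed[of a x] by (auto simp: toric_ideal_eq toric_hom_mult)
  qed
qed

definition exponent :: "'v multiset \<Rightarrow> 'v \<Rightarrow>\<^sub>0 nat" where
  "exponent M = (\<Sum>x\<in>#M. Poly_Mapping.single x 1)"

lemma exponent_union: "exponent (M + N) = exponent M + exponent N"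
  by (simp add: exponent_def)

lemma lookup_exponent: "Poly_Mapping.lookup (exponent M) x = count M x"
  by (induction M) (auto simp: exponent_def lookup_add lookup_single)

lemma keys_exponent: "Poly_Mapping.keys (exponent M) = set_mset M"
  by (auto simp: in_keys_iff lookup_exponent)

lemma exponent_surj: "\<exists>M. exponent M = e"
proof
  have "count (Abs_multiset (Poly_Mapping.lookup e)) = Poly_Mapping.lookup e"
    by (rule count_Abs_multiset) simp
  then show "exponent (Abs_multiset (Poly_Mapping.lookup e)) = e"
    by (intro poly_mapping_eqI) (simp only: lookup_exponent)
qed

lemma toric_degree_exponent: "toric_degree (exponent M) = (sum_mset M, int (size M))"
  by (induction M) (auto simp: exponent_def toric_degree_add zero_prod_def simp flip: One_nat_def)

definition monomial :: "'v multiset \<Rightarrow> ('v \<Rightarrow>\<^sub>0 nat) \<Rightarrow>\<^sub>0 complex" where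
  "monomial M = Poly_Mapping.single (exponent M) 1"

lemma monomial_union: "monomial (M + N) = monomial M * monomial N"
  by (simp add: monomial_def exponent_union mult_single)

lemma monomial_carrier: "set_mset M \<subseteq> X \<Longrightarrow> monomial M \<in> carrier (coordinate_ring X)"
  by (simp add: monomial_def keys_exponent)

lemma quadric_binomial:
  assumes "{x, y, x', y'} \<subseteq> lattice_points P" "x + y = x' + y'"
  shows "monomial {#x, y#} - monomial {#x', y'#} \<in> {f \<in> toric_ideal P. homogeneous_of_degree 2 f}"
proof -
  let ?f = "monomial {#x, y#} - monomial {#x', y'#}"
  have keys: "e = exponent {#x, y#} \<or> e = exponent {#x', y'#}" if "e \<in> Poly_Mapping.keys ?f" for e
    using that by (simp add: monomial_def in_keys_iff lookup_minus lookup_single when_def split: if_splits)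
  have "toric_hom ?f = 0"
    using assms(2) by (simp add: toric_hom_diff monomial_def toric_degree_exponent)
  moreover have "?f \<in> carrier (coordinate_ring (lattice_points P))"
    unfolding coordinate_ring_simps
  proof
    fix e assume "e \<in> Poly_Mapping.keys ?f"
    then have "e = exponent {#x, y#} \<or> e = exponent {#x', y'#}" by (rule keys)
    then show "Poly_Mapping.keys e \<subseteq> lattice_points P"
      using assms(1) by (elim disjE) (simp_all add: keys_exponent)
  qed
  moreover have "homogeneous_of_degree 2 ?f"
    unfolding homogeneous_of_degree_def
  proof
    fix e assume "e \<in> Poly_Mapping.keys ?f"
    then have "e = exponent {#x, y#} \<or> e = exponent {#x', y'#}" by (rule keys)
    moreover have "size {#x, y#} = 2" "size {#x', y'#} = 2" by simp_all
    ultimately obtain M where M: "e = exponent M" "size M = 2" by blast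
    then show "(\<Sum>m\<in>Poly_Mapping.keys e. Poly_Mapping.lookup e m) = 2"
      by (simp add: keys_exponent lookup_exponent size_multiset_overloaded_eq[symmetric])
  qed
  ultimately show ?thesis by (simp add: toric_ideal_eq)
qed

lemma binomial_in_ideal:
  assumes I: "ideal I (coordinate_ring (lattice_points P))"
    and Q: "{f \<in> toric_ideal P. homogeneous_of_degree 2 f} \<subseteq> I"
    and "exchange_equiv (lattice_points P) M N"
  shows "monomial M - monomial N \<in> I"
  using assms(3)
proof (induction rule: exchange_equiv.induct)
  let ?R = "coordinate_ring (lattice_points P)"
  interpret I: ideal I ?R by (rule I)
  case (exchange x y x' y')
  then show ?case using Q quadric_binomial[of x y x' y' P] by blast
next
  interpret I: ideal I "coordinate_ring (lattice_points P)" by (rule I)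
  case (refl M)
  then show ?case using additive_subgroup.zero_closed[OF I.is_additive_subgroup] by simp
next
  interpret I: ideal I "coordinate_ring (lattice_points P)" by (rule I)
  case (sym M N)
  have "Poly_Mapping.single 0 (- 1) \<in> carrier (coordinate_ring (lattice_points P))" by simp
  from I.I_l_closed[OF sym.IH this] show ?case
    by (simp add: single_uminus)
next
  interpret I: ideal I "coordinate_ring (lattice_points P)" by (rule I)
  case (trans M N K)
  show ?case using additive_subgroup.a_closed[OF I.is_additive_subgroup trans.IH] by simp
next
  interpret I: ideal I "coordinate_ring (lattice_points P)" by (rule I)
  case (add M N C)
  from I.I_r_closed[OF add.IH monomial_carrier[OF add.hyps(2)]] show ?case
    by (simp add: monomial_union algebra_simps)
qed

text \<open>Each monomial of an element \<open>f\<close> of the kernel shares its degree with another monomial of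
  \<open>f\<close>, since otherwise its coefficient would survive in the image. Subtracting a multiple of
  their binomial removes the first monomial and creates no new one.\<close>

lemma toric_ideal_subset_ideal:
  assumes I: "ideal I (coordinate_ring (lattice_points P))"
    and bin: "\<And>M N. \<lbrakk>set_mset M \<subseteq> lattice_points P; set_mset N \<subseteq> lattice_points P;
      size M = size N; sum_mset M = sum_mset N\<rbrakk> \<Longrightarrow> monomial M - monomial N \<in> I"
  shows "toric_ideal P \<subseteq> I"
proof
  let ?R = "coordinate_ring (lattice_points P)"
  interpret I: ideal I ?R by (rule I)
  fix f assume "f \<in> toric_ideal P"
  then show "f \<in> I"
  proof (induction "card (Poly_Mapping.keys f)" arbitrary: f rule: less_induct)
    case less
    then have f: "f \<in> carrier ?R" "toric_hom f = 0" by (auto simp: toric_ideal_eq)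
    show ?case
    proof (cases "f = 0")
      case True
      then show ?thesis using additive_subgroup.zero_closed[OF I.is_additive_subgroup] by simp
    next
      case False
      then obtain e where "Poly_Mapping.lookup f e \<noteq> Poly_Mapping.lookup 0 e"
        using poly_mapping_eqI[of f 0] by blast
      then have e: "e \<in> Poly_Mapping.keys f" by (simp add: in_keys_iff)
      let ?c = "Poly_Mapping.lookup f e"
      obtain e' where e': "e' \<in> Poly_Mapping.keys f" "e' \<noteq> e" "toric_degree e' = toric_degree e"
      proof (rule ccontr)
        note obtained = that
        assume n: "\<not> thesis"
        have "e' = e" if "e' \<in> Poly_Mapping.keys f" "toric_degree e' = toric_degree e" for e'
          using n that obtained by blast
        then have "{e' \<in> Poly_Mapping.keys f. toric_degree e' = toric_degree e} = {e}"
          using e by auto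
        then show False
          using lookup_toric_hom[of f "toric_degree e"] f(2) e by (simp add: in_keys_iff)
      qed
      obtain M N where MN: "e = exponent M" "e' = exponent N" using exponent_surj by metis
      have "monomial M - monomial N \<in> I"
      proof (rule bin)
        have "Poly_Mapping.keys e \<subseteq> lattice_points P" "Poly_Mapping.keys e' \<subseteq> lattice_points P"
          using f(1) e e'(1) by simp_all
        then show "set_mset M \<subseteq> lattice_points P" "set_mset N \<subseteq> lattice_points P"
          by (simp_all add: MN keys_exponent)
        show "size M = size N" "sum_mset M = sum_mset N"
          using e'(3) by (simp_all add: MN toric_degree_exponent)
      qed
      then have b: "Poly_Mapping.single 0 ?c * (monomial M - monomial N) \<in> I"
        using I.I_l_closed[of _ "Poly_Mapping.single 0 ?c"] by simp
      define g where "g = f - Poly_Mapping.single 0 ?c * (monomial M - monomial N)"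
      have g: "g = f - (Poly_Mapping.single e ?c - Poly_Mapping.single e' ?c)"
        by (simp add: g_def MN monomial_def right_diff_distrib mult_single)
      have "Poly_Mapping.keys g \<subseteq> Poly_Mapping.keys f - {e}"
        using e e' by (auto simp: g in_keys_iff lookup_minus lookup_single when_def split: if_splits)
      moreover from this have "card (Poly_Mapping.keys g) < card (Poly_Mapping.keys f)"
        using e by (intro psubset_card_mono) auto
      moreover have "toric_hom g = 0" using f(2) e'(3) by (simp add: g toric_hom_diff)
      ultimately have "g \<in> I" using less(1)[of g] f(1) by (auto simp: toric_ideal_eq)
      from additive_subgroup.a_closed[OF I.is_additive_subgroup this b] show ?thesis by (simp add: g_def)
    qed
  qed
qed

lemma toric_ideal_generated_by_quadrics:
  assumes "\<And>M N. \<lbrakk>set_mset M \<subseteq> lattice_points P; set_mset N \<subseteq> lattice_points P;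
      size M = size N; sum_mset M = sum_mset N\<rbrakk> \<Longrightarrow> exchange_equiv (lattice_points P) M N"
  shows "toric_ideal P =
           genideal (coordinate_ring (lattice_points P))
             {f \<in> toric_ideal P. homogeneous_of_degree 2 f}"
proof
  let ?R = "coordinate_ring (lattice_points P)"
  show "toric_ideal P \<subseteq> genideal ?R {f \<in> toric_ideal P. homogeneous_of_degree 2 f}"
    unfolding genideal_def
  proof (rule Inter_greatest)
    fix I assume "I \<in> {I. ideal I ?R \<and> {f \<in> toric_ideal P. homogeneous_of_degree 2 f} \<subseteq> I}"
    then have I: "ideal I ?R" and Q: "{f \<in> toric_ideal P. homogeneous_of_degree 2 f} \<subseteq> I"
      by simp_all
    show "toric_ideal P \<subseteq> I"
      by (rule toric_ideal_subset_ideal[OF I]) (rule binomial_in_ideal[OF I Q assms])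
  qed
  show "genideal ?R {f \<in> toric_ideal P. homogeneous_of_degree 2 f} \<subseteq> toric_ideal P"
    unfolding genideal_def by (rule Inter_lower) (simp add: ideal_toric_ideal Collect_conj_eq)
qed

section \<open>Dual vectors and rays of the vertex cone\<close>

text \<open>Integral independence of a basis of the lattice gives real dual vectors: the coordinates of the standard
  unit vectors in the basis assemble to them.\<close>

lemma int_basis_dual:
  fixes B :: "(real ^ 'n) set"
  assumes B: "int_basis B" and b: "b \<in> B"
  obtains g :: "real ^ 'n" where "g \<bullet> b = 1" "\<And>b'. b' \<in> B \<Longrightarrow> b' \<noteq> b \<Longrightarrow> g \<bullet> b' = 0"
proof -
  have fin: "finite B"
    and gen: "{(\<Sum>b\<in>B. of_int (c b) *\<^sub>R b) | c :: real ^ 'n \<Rightarrow> int. True} = int_lattice"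
    and ind: "\<And>c :: real ^ 'n \<Rightarrow> int. (\<Sum>b\<in>B. of_int (c b) *\<^sub>R b) = 0 \<Longrightarrow> \<forall>b\<in>B. c b = 0"
    using B unfolding int_basis_def by blast+
  have "axis i (1::real) \<in> int_lattice" for i :: 'n
    by (auto simp: int_lattice_def axis_def)
  then have "\<forall>i::'n. \<exists>c :: real ^ 'n \<Rightarrow> int. axis i (1::real) = (\<Sum>b\<in>B. of_int (c b) *\<^sub>R b)"
    unfolding gen[symmetric] by blast
  then obtain c :: "'n \<Rightarrow> real ^ 'n \<Rightarrow> int"
    where c: "\<And>i. axis i (1::real) = (\<Sum>b\<in>B. of_int (c i b) *\<^sub>R b)" by metis
  define g :: "real ^ 'n" where "g = (\<chi> i. of_int (c i b))"
  have "g \<bullet> b' = (if b' = b then 1 else 0)" if b': "b' \<in> B" for b'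
  proof -
    have "(\<Sum>d\<in>B. of_int (if d = b' then 1 else 0) *\<^sub>R d) = (\<Sum>d\<in>B. if d = b' then d else 0)"
      by (intro sum.cong) auto
    also have "\<dots> = b'" using fin b' by simp
    finally have ind_b': "(\<Sum>d\<in>B. of_int (if d = b' then 1 else 0) *\<^sub>R d) = b'" .
    then have "b' \<in> int_lattice" unfolding gen[symmetric]
      by (intro CollectI exI[of _ "\<lambda>d. if d = b' then 1 else 0"] conjI TrueI) (rule HOL.sym)
    define z where "z i = \<lfloor>b' $ i\<rfloor>" for i
    have z: "b' $ i = of_int (z i)" for i
      using \<open>b' \<in> int_lattice\<close> by (simp add: int_lattice_def z_def)
    have "b' = (\<Sum>i\<in>UNIV. (b' $ i) *\<^sub>R axis i (1::real))"
      using basis_expansion[of b'] by (simp add: scalar_mult_eq_scaleR)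
    also have "\<dots> = (\<Sum>i\<in>UNIV. \<Sum>d\<in>B. of_int (z i * c i d) *\<^sub>R d)"
      by (simp add: c z scaleR_right.sum)
    also have "\<dots> = (\<Sum>d\<in>B. of_int (\<Sum>i\<in>UNIV. z i * c i d) *\<^sub>R d)"
      by (subst sum.swap) (simp add: scaleR_left.sum)
    finally have "(\<Sum>d\<in>B. of_int ((\<Sum>i\<in>UNIV. z i * c i d) - (if d = b' then 1 else 0)) *\<^sub>R d) = 0"
      using ind_b' by (simp add: scaleR_left_diff_distrib sum_subtractf del: of_int_sum)
    from ind[OF this] b have "(\<Sum>i\<in>UNIV. z i * c i b) = (if b = b' then 1 else 0)" by fastforce
    moreover have "g \<bullet> b' = of_int (\<Sum>i\<in>UNIV. z i * c i b)"
      by (simp add: g_def inner_vec_def z mult.commute)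
    ultimately show ?thesis by auto
  qed
  then show thesis using that[of g] b by auto
qed

text \<open>The squared norm of a lattice vector is a natural number, so a minimum is attained.\<close>

lemma shortest_lattice_vector:
  assumes "x \<in> S" "S \<subseteq> int_lattice"
  shows "\<exists>u\<in>S. \<forall>w\<in>S. norm u \<le> norm w"
proof -
  have int: "of_nat (nat \<lfloor>(norm w)\<^sup>2\<rfloor>) = (norm w)\<^sup>2" if "w \<in> S" for w
  proof -
    have "(norm w)\<^sup>2 = (\<Sum>i\<in>UNIV. w $ i * w $ i)" by (simp add: power2_norm_eq_inner inner_vec_def)
    also have "\<dots> \<in> \<int>" using that assms(2) by (intro Ints_sum Ints_mult) (auto simp: int_lattice_def)
    finally show ?thesis by (auto elim!: Ints_cases simp: of_nat_nat)
  qed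
  obtain u where u: "u \<in> S" "\<And>w. w \<in> S \<Longrightarrow> nat \<lfloor>(norm u)\<^sup>2\<rfloor> \<le> nat \<lfloor>(norm w)\<^sup>2\<rfloor>"
    using ex_has_least_nat[of "\<lambda>w. w \<in> S" x "\<lambda>w. nat \<lfloor>(norm w)\<^sup>2\<rfloor>"] assms(1) by blast
  have "norm u \<le> norm w" if "w \<in> S" for w
  proof (rule power2_le_imp_le)
    show "(norm u)\<^sup>2 \<le> (norm w)\<^sup>2"
      using u(2)[OF that] int[OF u(1)] int[OF that] by (metis of_nat_le_iff)
  qed simp
  then show ?thesis using u(1) by blast
qed

definition nonneg_combinations :: "'a::real_vector set \<Rightarrow> 'a set" where
  "nonneg_combinations R = {\<Sum>u\<in>R. c u *\<^sub>R u | c. \<forall>u\<in>R. 0 \<le> c u}"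

lemma nonneg_combinations_0: "0 \<in> nonneg_combinations R"
  unfolding nonneg_combinations_def by (rule CollectI, rule exI[of _ "\<lambda>_. 0"]) simp

lemma nonneg_combinations_add:
  assumes "x \<in> nonneg_combinations R" "y \<in> nonneg_combinations R"
  shows "x + y \<in> nonneg_combinations R"
proof -
  obtain c d where "x = (\<Sum>u\<in>R. c u *\<^sub>R u)" "y = (\<Sum>u\<in>R. d u *\<^sub>R u)" "\<forall>u\<in>R. 0 \<le> c u" "\<forall>u\<in>R. 0 \<le> d u"
    using assms unfolding nonneg_combinations_def by blast
  then have "x + y = (\<Sum>u\<in>R. (c u + d u) *\<^sub>R u)" "\<forall>u\<in>R. 0 \<le> c u + d u"
    by (auto simp: scaleR_add_left sum.distrib)
  then show ?thesis unfolding nonneg_combinations_def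
    by (intro CollectI exI[of _ "\<lambda>u. c u + d u"]) auto
qed

lemma nonneg_combinations_scale:
  assumes "x \<in> nonneg_combinations R" "0 \<le> l"
  shows "l *\<^sub>R x \<in> nonneg_combinations R"
proof -
  obtain c where "x = (\<Sum>u\<in>R. c u *\<^sub>R u)" "\<forall>u\<in>R. 0 \<le> c u"
    using assms unfolding nonneg_combinations_def by blast
  then have "l *\<^sub>R x = (\<Sum>u\<in>R. (l * c u) *\<^sub>R u)" "\<forall>u\<in>R. 0 \<le> l * c u"
    using assms(2) by (auto simp: scaleR_right.sum)
  then show ?thesis unfolding nonneg_combinations_def
    by (intro CollectI exI[of _ "\<lambda>u. l * c u"]) auto
qed

lemma nonneg_combinations_base:
  assumes "finite R" "u \<in> R"
  shows "u \<in> nonneg_combinations R"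
proof -
  have "(\<Sum>w\<in>R. (if w = u then 1 else 0) *\<^sub>R w) = (\<Sum>w\<in>R. if w = u then w else 0)"
    by (intro sum.cong) auto
  then have "u = (\<Sum>w\<in>R. (if w = u then 1 else 0) *\<^sub>R w)" using assms by simp
  then show ?thesis unfolding nonneg_combinations_def
    by (intro CollectI exI[of _ "\<lambda>w. if w = u then 1 else 0"]) auto
qed

lemma nonneg_combinations_sum:
  "finite I \<Longrightarrow> (\<And>i. i \<in> I \<Longrightarrow> f i \<in> nonneg_combinations R) \<Longrightarrow> sum f I \<in> nonneg_combinations R"
  by (induction I rule: finite_induct) (auto intro: nonneg_combinations_0 nonneg_combinations_add)

lemma convex_nonneg_combinations: "convex (nonneg_combinations R)"
  by (auto simp: convex_def intro: nonneg_combinations_add nonneg_combinations_scale)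

lemma vertex_cone_scale:
  assumes "x \<in> vertex_cone P v" "0 \<le> l"
  shows "l *\<^sub>R x \<in> vertex_cone P v"
proof -
  obtain k p where "x = k *\<^sub>R (p - v)" "0 \<le> k" "p \<in> P" using assms by (auto simp: vertex_cone_def)
  then have "l *\<^sub>R x = (l * k) *\<^sub>R (p - v)" "0 \<le> l * k" "p \<in> P" using assms(2) by auto
  then show ?thesis unfolding vertex_cone_def by blast
qed

lemma vertex_cone_base: "p \<in> P \<Longrightarrow> p - v \<in> vertex_cone P v"
  unfolding vertex_cone_def by (rule CollectI, rule exI[of _ 1]) auto

text \<open>A linear form \<open>g\<close> that is positive on all nonzero directions from \<open>v\<close> cuts the
  cone in a polytope \<open>T\<close>, which is the convex hull of its extreme points. An extreme point of
  \<open>T\<close> spans an edge of the cone, and this edge contains a lattice vector because it contains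
  \<open>w - v\<close> for one of the generators \<open>w\<close> of the polytope. Finiteness of
  \<open>R\<close> lets \<open>nonneg_combinations R\<close> be read as the cone generated by
  \<open>R\<close>.\<close>

lemma vertex_cone_generated:
  fixes V :: "(real ^ 'n) set"
  assumes V: "finite V" "V \<subseteq> int_lattice" and v: "v extreme_point_of (convex hull V)"
    and R: "R = ray_generators (vertex_cone (convex hull V) v)" "finite R"
  shows "vertex_cone (convex hull V) v \<subseteq> nonneg_combinations R"
proof -
  define C where "C = vertex_cone (convex hull V) v"
  define W where "W = V - {v}"
  have finW: "finite W" using V(1) by (simp add: W_def)
  have vV: "v \<in> V" using extreme_point_of_convex_hull[OF v] .
  have VP: "V \<subseteq> convex hull V" by (rule hull_subset)
  have "convex (convex hull V - {v})" using v by (simp add: extreme_point_of_stillconvex)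
  then have "convex hull W \<subseteq> convex hull V - {v}"
    using VP by (intro hull_minimal) (auto simp: W_def)
  then have "v \<notin> convex hull W" by blast
  then obtain g b where g: "g \<bullet> v < b" "\<And>x. x \<in> convex hull W \<Longrightarrow> b < g \<bullet> x"
    using separating_hyperplane_closed_point[of "convex hull W" v] finW
    by (auto simp: finite_imp_compact_convex_hull compact_imp_closed)
  have gpos: "0 < g \<bullet> (w - v)" if "w \<in> W" for w
  proof -
    have "w \<in> convex hull W" using that by (simp add: hull_inc)
    then show ?thesis using g(1) g(2)[of w] by (simp add: inner_diff_right)
  qed
  define t where "t w = (1 / (g \<bullet> (w - v))) *\<^sub>R (w - v)" for w
  define T where "T = convex hull (t ` W)"
  have gt: "g \<bullet> t w = 1" if "w \<in> W" for w using gpos[OF that] by (simp add: t_def)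
  have tw: "w - v = (g \<bullet> (w - v)) *\<^sub>R t w" if "w \<in> W" for w using gpos[OF that] by (simp add: t_def)
  have repr: "\<exists>k. (\<forall>w\<in>W. 0 \<le> k w) \<and> x = (\<Sum>w\<in>W. k w *\<^sub>R t w)" if xC: "x \<in> C" for x
  proof -
    obtain l p where l: "x = l *\<^sub>R (p - v)" "0 \<le> l" "p \<in> convex hull V"
      using xC unfolding C_def vertex_cone_def by blast
    obtain \<mu> where \<mu>: "\<forall>w\<in>V. 0 \<le> \<mu> w" "sum \<mu> V = 1" "(\<Sum>w\<in>V. \<mu> w *\<^sub>R w) = p"
      using l(3) unfolding convex_hull_finite[OF V(1)] by blast
    have "p - v = (\<Sum>w\<in>V. \<mu> w *\<^sub>R (w - v))"
      using \<mu>(2,3) by (simp add: scaleR_diff_right sum_subtractf flip: scaleR_left.sum)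
    also have "\<dots> = (\<Sum>w\<in>W. \<mu> w *\<^sub>R (w - v))"
      unfolding W_def using V(1) vV by (simp add: sum.remove[of V v])
    also have "\<dots> = (\<Sum>w\<in>W. (\<mu> w * (g \<bullet> (w - v))) *\<^sub>R t w)"
      using tw by (intro sum.cong) (auto simp flip: scaleR_scaleR)
    finally have "x = (\<Sum>w\<in>W. (l * (\<mu> w * (g \<bullet> (w - v)))) *\<^sub>R t w)"
      unfolding l(1) by (simp add: scaleR_right.sum)
    moreover have "\<forall>w\<in>W. 0 \<le> l * (\<mu> w * (g \<bullet> (w - v)))"
      using l(2) \<mu>(1) gpos by (intro ballI mult_nonneg_nonneg less_imp_le[OF gpos]) (auto simp: W_def)
    ultimately show ?thesis by (intro exI[of _ "\<lambda>w. l * (\<mu> w * (g \<bullet> (w - v)))"] conjI)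
  qed
  have slice: "x = 0 \<and> g \<bullet> x = 0 \<or> 0 < g \<bullet> x \<and> (1 / (g \<bullet> x)) *\<^sub>R x \<in> T" if xC: "x \<in> C" for x
  proof -
    obtain k where k: "\<forall>w\<in>W. 0 \<le> k w" "x = (\<Sum>w\<in>W. k w *\<^sub>R t w)" using repr[OF xC] by blast
    have gx: "g \<bullet> x = sum k W" using gt by (simp add: k(2) inner_sum_right)
    show ?thesis
    proof (cases "sum k W = 0")
      case True
      then have "\<forall>w\<in>W. k w = 0" using k(1) finW by (simp add: sum_nonneg_eq_0_iff)
      then show ?thesis using k(2) by simp
    next
      case False
      then have pos: "0 < sum k W" using k(1) by (metis order_le_less sum_nonneg)
      have "(1 / (g \<bullet> x)) *\<^sub>R x = (\<Sum>w\<in>W. (k w / sum k W) *\<^sub>R t w)"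
        by (simp add: gx, simp add: k(2) scaleR_right.sum)
      also have "\<dots> \<in> T"
      proof (rule convex_sum)
        show "(\<Sum>w\<in>W. k w / sum k W) = 1" using pos by (simp flip: sum_divide_distrib)
        show "\<And>w. w \<in> W \<Longrightarrow> 0 \<le> k w / sum k W" using k(1) pos by simp
        show "\<And>w. w \<in> W \<Longrightarrow> t w \<in> T" by (simp add: T_def hull_inc)
      qed (simp_all add: T_def finW)
      finally show ?thesis using pos gx by simp
    qed
  qed
  have extreme: "s \<in> nonneg_combinations R" if s: "s extreme_point_of T" for s
  proof -
    obtain w where w: "w \<in> W" "s = t w" using extreme_point_of_convex_hull s unfolding T_def by blast
    have gs: "g \<bullet> s = 1" using gt w by simp
    have "w - v \<in> C" unfolding C_def using w(1) VP by (intro vertex_cone_base) (auto simp: W_def)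
    then have sC: "s \<in> C" unfolding w(2) t_def C_def using gpos[OF w(1)]
      by (intro vertex_cone_scale) simp_all
    have s0: "s \<noteq> 0" using gs by auto
    define E where "E = {l *\<^sub>R s | l. 0 \<le> l}"
    \<comment> \<open>An element of the cone lies on the ray of \<open>s\<close> as soon as its scaling to \<open>T\<close> is \<open>s\<close>.\<close>
    have EI: "a \<in> E" if a: "a \<in> C" "a \<noteq> 0 \<Longrightarrow> (1 / (g \<bullet> a)) *\<^sub>R a = s" for a
    proof (cases "a = 0")
      case True
      then show ?thesis unfolding E_def by (intro CollectI exI[of _ 0]) simp
    next
      case False
      then have "0 < g \<bullet> a" using slice[OF a(1)] by blast
      then show ?thesis using a(2)[OF False] unfolding E_def
        by (intro CollectI exI[of _ "g \<bullet> a"]) auto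
    qed
    have face: "E face_of C"
      unfolding face_of_def
    proof (intro conjI ballI impI)
      show "E \<subseteq> C" using sC vertex_cone_scale unfolding E_def C_def by blast
      show "convex E"
      proof (rule convexI)
        fix x y and \<alpha> \<beta> :: real assume "x \<in> E" "y \<in> E" and ab: "0 \<le> \<alpha>" "0 \<le> \<beta>"
        then obtain l m where "x = l *\<^sub>R s" "y = m *\<^sub>R s" "0 \<le> l" "0 \<le> m" unfolding E_def by blast
        then have "\<alpha> *\<^sub>R x + \<beta> *\<^sub>R y = (\<alpha> * l + \<beta> * m) *\<^sub>R s" "0 \<le> \<alpha> * l + \<beta> * m"
          using ab by (auto simp: scaleR_add_left)
        then show "\<alpha> *\<^sub>R x + \<beta> *\<^sub>R y \<in> E" unfolding E_def by blast
      qed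
      fix a b x assume a: "a \<in> C" and b: "b \<in> C" and x: "x \<in> E" "x \<in> open_segment a b"
      obtain l where l: "x = l *\<^sub>R s" "0 \<le> l" using x(1) by (auto simp: E_def)
      obtain r where r: "0 < r" "r < 1" "x = (1 - r) *\<^sub>R a + r *\<^sub>R b" using x(2) by (auto simp: in_segment)
      define \<alpha> \<beta> where "\<alpha> = g \<bullet> a" and "\<beta> = g \<bullet> b"
      have l_eq: "l = (1 - r) * \<alpha> + r * \<beta>"
        using arg_cong[OF r(3), of "\<lambda>z. g \<bullet> z"] gs by (simp add: l(1) inner_add_right \<alpha>_def \<beta>_def)
      have "(a \<noteq> 0 \<longrightarrow> (1 / \<alpha>) *\<^sub>R a = s) \<and> (b \<noteq> 0 \<longrightarrow> (1 / \<beta>) *\<^sub>R b = s)"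
      proof -
        consider "a = 0" | "b = 0" | "a \<noteq> 0" "b \<noteq> 0" by blast
        then show ?thesis
        proof cases
          case 1
          then have "r *\<^sub>R b = (r * \<beta>) *\<^sub>R s" using r(3) l(1) l_eq by (simp add: \<alpha>_def)
          then have "b = \<beta> *\<^sub>R s" using r(1) by (simp flip: scaleR_scaleR)
          then show ?thesis using 1 by auto
        next
          case 2
          then have "(1 - r) *\<^sub>R a = ((1 - r) * \<alpha>) *\<^sub>R s" using r(3) l(1) l_eq by (simp add: \<beta>_def)
          then have "a = \<alpha> *\<^sub>R s" using r(2) by (simp flip: scaleR_scaleR)
          then show ?thesis using 2 by auto
        next
          case 3
          define a' b' where "a' = (1 / \<alpha>) *\<^sub>R a" and "b' = (1 / \<beta>) *\<^sub>R b"
          have pos: "0 < \<alpha>" "0 < \<beta>" and T: "a' \<in> T" "b' \<in> T"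
            using slice[OF a] slice[OF b] 3 by (auto simp: \<alpha>_def \<beta>_def a'_def b'_def)
          have lpos: "0 < l" using l_eq pos r by (simp add: add_pos_pos)
          define q where "q = r * \<beta> / l"
          have q: "0 < q" "q < 1" "1 - q = (1 - r) * \<alpha> / l"
          proof -
            show "0 < q" using r pos lpos by (simp add: q_def)
            show e: "1 - q = (1 - r) * \<alpha> / l" using lpos l_eq by (simp add: q_def field_simps)
            have "0 < (1 - r) * \<alpha> / l" using r pos lpos by simp
            then show "q < 1" using e by linarith
          qed
          have "l *\<^sub>R s = (1 - r) *\<^sub>R (\<alpha> *\<^sub>R a') + r *\<^sub>R (\<beta> *\<^sub>R b')"
            using r(3) l(1) pos by (simp add: a'_def b'_def)
          then have "(1 / l) *\<^sub>R (l *\<^sub>R s) = (1 / l) *\<^sub>R ((1 - r) *\<^sub>R (\<alpha> *\<^sub>R a') + r *\<^sub>R (\<beta> *\<^sub>R b'))" by simp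
          then have comb: "s = (1 - q) *\<^sub>R a' + q *\<^sub>R b'"
            using lpos unfolding q(3) by (simp add: q_def scaleR_add_right)
          have "s \<notin> open_segment a' b'" using s T unfolding extreme_point_of_def by blast
          then have "a' = b'" using comb q(1,2) unfolding in_segment by blast
          then have "a' = s" "b' = s" using comb by (simp_all flip: scaleR_add_left)
          then show ?thesis by (simp add: a'_def b'_def)
        qed
      qed
      then show "a \<in> E" "b \<in> E" using EI[OF a] EI[OF b] by (simp_all add: \<alpha>_def \<beta>_def)
    qed
    have "aff_dim E = 1"
    proof (rule antisym)
      have "E \<subseteq> affine hull {0, s}"
      proof
        fix x assume "x \<in> E"
        then obtain l where "x = l *\<^sub>R s" by (auto simp: E_def)
        then show "x \<in> affine hull {0, s}" unfolding affine_hull_2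
          by (intro CollectI exI[of _ "1 - l"] exI[of _ l]) simp
      qed
      from aff_dim_subset[OF this] show "aff_dim E \<le> 1" using s0 by simp
      have "0 \<in> E" "s \<in> E" unfolding E_def using exI[of _ "0::real"] exI[of _ "1::real"] by force+
      then have "{0, s} \<subseteq> E" by simp
      from aff_dim_subset[OF this] show "1 \<le> aff_dim E" using s0 by simp
    qed
    then have edge: "E edge_of C" using face by (simp add: edge_of_def)
    define S where "S = E \<inter> int_lattice - {0}"
    have "w - v \<in> S"
    proof -
      have "w - v = (g \<bullet> (w - v)) *\<^sub>R s" using tw w by simp
      then have "w - v \<in> E" unfolding E_def using less_imp_le[OF gpos[OF w(1)]] by blast
      moreover have "w \<in> int_lattice" "v \<in> int_lattice" using V(2) vV w(1) by (auto simp: W_def)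
      then have "w - v \<in> int_lattice" by (simp add: int_lattice_def)
      moreover have "w - v \<noteq> 0" using gpos[OF w(1)] by auto
      ultimately show ?thesis by (simp add: S_def)
    qed
    then obtain u where u: "u \<in> S" "\<forall>w\<in>S. norm u \<le> norm w"
      using shortest_lattice_vector[of "w - v" S] by (auto simp: S_def)
    then have "u \<in> R" unfolding R ray_generators_def using edge by (auto simp: S_def C_def)
    moreover obtain l where l: "u = l *\<^sub>R s" "0 \<le> l" using u(1) by (auto simp: S_def E_def)
    moreover have "l \<noteq> 0" using u(1) l(1) by (auto simp: S_def)
    ultimately have "s = (1 / l) *\<^sub>R u" "u \<in> nonneg_combinations R"
      using nonneg_combinations_base[OF R(2)] by auto
    then show ?thesis using l(2) nonneg_combinations_scale[of u R "1 / l"] by simp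
  qed
  have "T = convex hull {s. s extreme_point_of T}"
    unfolding T_def by (rule Krein_Milman_polytope) (simp add: finW)
  also have "\<dots> \<subseteq> nonneg_combinations R"
    using extreme convex_nonneg_combinations by (intro hull_minimal) auto
  finally have TR: "T \<subseteq> nonneg_combinations R" .
  show ?thesis
  proof
    fix x assume "x \<in> vertex_cone (convex hull V) v"
    then obtain k where k: "\<forall>w\<in>W. 0 \<le> k w" "x = (\<Sum>w\<in>W. k w *\<^sub>R t w)"
      using repr unfolding C_def by blast
    have "k w *\<^sub>R t w \<in> nonneg_combinations R" if "w \<in> W" for w
      using that k(1) TR by (intro nonneg_combinations_scale) (auto simp: T_def hull_inc)
    then show "x \<in> nonneg_combinations R" unfolding k(2) using finW by (intro nonneg_combinations_sum)
  qed
qed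

section \<open>Facet heights of a compressed polytope\<close>

locale compressed_polytope =
  fixes P :: "(real ^ 'n) set"
  assumes lattice: "lattice_polytope P" and compressed: "compressed P"
begin

definition facets :: "(real ^ 'n) set set" where
  "facets = {F. F facet_of P}"

definition facet_data :: "(real ^ 'n) set \<Rightarrow> (real ^ 'n) \<times> real" where
  "facet_data F = (SOME (a, c). facet_inequality P F a c \<and> width P a c = 1)"

definition height :: "(real ^ 'n) set \<Rightarrow> real ^ 'n \<Rightarrow> real" where
  "height F x = x \<bullet> fst (facet_data F) - snd (facet_data F)"

definition affine_lattice :: "(real ^ 'n) set" where
  "affine_lattice = affine hull P \<inter> int_lattice"

text \<open>The floor only changes the type: heights are integers on the affine lattice.\<close>

definition lattice_height :: "(real ^ 'n) set \<Rightarrow> real ^ 'n \<Rightarrow> int" where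
  "lattice_height F x = \<lfloor>height F x\<rfloor>"

lemma polytope: "polytope P"
  using lattice polytope_convex_hull unfolding lattice_polytope_def by blast

lemma convex: "convex P" and compact: "compact P" and bounded: "bounded P" and polyhedron: "polyhedron P"
  using polytope by (simp_all add: polytope_imp_convex polytope_imp_compact polytope_imp_bounded polytope_imp_polyhedron)

lemma extreme_point_lattice: "x extreme_point_of P \<Longrightarrow> x \<in> int_lattice"
  using lattice extreme_point_of_convex_hull unfolding lattice_polytope_def by blast

lemma facet_data:
  assumes "F \<in> facets"
  shows "facet_inequality P F (fst (facet_data F)) (snd (facet_data F))"
    and "width P (fst (facet_data F)) (snd (facet_data F)) = 1"
proof -
  have "\<exists>z. case z of (a, c) \<Rightarrow> facet_inequality P F a c \<and> width P a c = 1"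
    using compressed assms unfolding compressed_def facets_def by auto
  from someI_ex[OF this] show "facet_inequality P F (fst (facet_data F)) (snd (facet_data F))"
    "width P (fst (facet_data F)) (snd (facet_data F)) = 1"
    unfolding facet_data_def[symmetric] by (simp_all add: case_prod_beta)
qed

lemma facet_eq: "F \<in> facets \<Longrightarrow> F = {x \<in> P. height F x = 0}"
  using facet_data(1) by (simp add: facet_inequality_def height_def)

lemma height_nonneg: "F \<in> facets \<Longrightarrow> x \<in> P \<Longrightarrow> 0 \<le> height F x"
  using facet_data(1) by (simp add: facet_inequality_def height_def)

lemma height_le_one:
  assumes "F \<in> facets" "x \<in> P"
  shows "height F x \<le> 1"
proof -
  have "compact ((\<lambda>x. height F x) ` P)"
    unfolding height_def by (intro compact_continuous_image continuous_intros compact)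
  then have "bdd_above ((\<lambda>x. height F x) ` P)" by (intro bounded_imp_bdd_above compact_imp_bounded)
  then have "height F x \<le> (SUP x\<in>P. height F x)" using assms(2) by (rule cSUP_upper2) simp
  then show ?thesis using facet_data(2)[OF assms(1)] by (simp add: width_def height_def)
qed

lemma height_add_diff: "height F (x + (y - z)) = height F x + (height F y - height F z)"
  by (simp add: height_def inner_add_left inner_diff_left)

lemma height_line: "height F ((1 - t) *\<^sub>R x + t *\<^sub>R y) = (1 - t) * height F x + t * height F y"
  by (simp add: height_def inner_add_left algebra_simps)

lemma facet_nonempty_vertex:
  assumes "F face_of P" "F \<noteq> {}"
  shows "\<exists>p\<in>F. p extreme_point_of P"
proof -
  have "compact F" using face_of_polytope_polytope[OF polytope assms(1)] by (rule polytope_imp_compact)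
  then obtain p where "p extreme_point_of F"
    using extreme_point_exists_convex[of F] face_of_imp_convex[OF assms(1)] assms(2) by blast
  then show ?thesis using extreme_point_of_face[OF assms(1)] by blast
qed

lemma affine_lattice_closed:
  assumes "x \<in> affine_lattice" "y \<in> affine_lattice" "z \<in> affine_lattice"
  shows "x + (y - z) \<in> affine_lattice"
proof -
  have "x + 1 *\<^sub>R (y - z) \<in> affine hull P"
    using assms by (intro mem_affine_3_minus affine_affine_hull) (auto simp: affine_lattice_def)
  then show ?thesis using assms by (auto simp: affine_lattice_def int_lattice_def)
qed

text \<open>The height vanishes at a vertex \<open>p\<close> of \<open>F\<close>, which is a lattice point, and the
  normal pairs integrally with the lattice vector \<open>x - p\<close>.\<close>

lemma height_Ints:
  assumes F: "F \<in> facets" and x: "x \<in> affine_lattice"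
  shows "height F x \<in> \<int>"
proof -
  have "F face_of P" "F \<noteq> {}" using F by (auto simp: facets_def facet_of_def)
  then obtain p where p: "p \<in> F" "p extreme_point_of P" using facet_nonempty_vertex by blast
  have pP: "p \<in> P" using p(2) by (simp add: extreme_point_of_def)
  have "x - p \<in> (\<lambda>x. x - p) ` (affine hull P)" using x by (auto simp: affine_lattice_def)
  also have "\<dots> = span ((\<lambda>x. x - p) ` P)" using pP by (rule diffs_affine_hull_span)
  also have "\<dots> \<subseteq> direction_space P" unfolding direction_space_def using pP by (intro span_mono) blast
  finally have "x - p \<in> direction_space P" .
  moreover have "x - p \<in> int_lattice"
    using x extreme_point_lattice[OF p(2)] by (auto simp: affine_lattice_def int_lattice_def)
  ultimately have "fst (facet_data F) \<bullet> (x - p) \<in> \<int>"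
    using facet_data(1)[OF F]
    by (auto simp: facet_inequality_def primitive_normal_def dual_lattice_def induced_lattice_def)
  moreover have "height F p = 0" using p(1) facet_eq[OF F] by blast
  ultimately show ?thesis by (simp add: height_def inner_diff_left inner_diff_right inner_commute)
qed

lemma of_int_lattice_height:
  assumes "F \<in> facets" "x \<in> affine_lattice"
  shows "of_int (lattice_height F x) = height F x"
  using height_Ints[OF assms] by (simp add: lattice_height_def)

text \<open>The facet presentation. A point of the affine span outside \<open>P\<close> is separated from a relative
  interior point by some facet, where the segment between them leaves \<open>P\<close>; the height over this
  facet is negative.\<close>

lemma in_polytopeI:
  assumes x: "x \<in> affine hull P" and h: "\<And>F. F \<in> facets \<Longrightarrow> 0 \<le> height F x"
  shows "x \<in> P"
proof (rule ccontr)
  assume xP: "x \<notin> P"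
  have "P \<noteq> {}" using x by auto
  then obtain z where z: "z \<in> rel_interior P" using rel_interior_eq_empty[OF convex] by blast
  have zP: "z \<in> P" using z rel_interior_subset by blast
  have "x - z \<noteq> 0" using xP zP by auto
  then obtain d where d: "0 < d" "z + d *\<^sub>R (x - z) \<in> rel_frontier P"
    "\<And>e. \<lbrakk>0 \<le> e; e < d\<rbrakk> \<Longrightarrow> z + e *\<^sub>R (x - z) \<in> rel_interior P"
    using ray_to_rel_frontier[OF bounded z, of "x - z"] x by auto
  obtain F where F: "F \<in> facets" "z + d *\<^sub>R (x - z) \<in> F"
    using d(2) rel_frontier_of_polyhedron[OF polyhedron] by (auto simp: facets_def)
  have y0: "height F (z + d *\<^sub>R (x - z)) = 0" and yP: "z + d *\<^sub>R (x - z) \<in> P"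
    using F(2) facet_eq[OF F(1)] by blast+
  have "z \<notin> F" using z rel_boundary_of_polyhedron[OF polyhedron] F(1) unfolding facets_def by blast
  then have "height F z \<noteq> 0" using facet_eq[OF F(1)] zP by blast
  then have z_pos: "0 < height F z" using height_nonneg[OF F(1) zP] by simp
  have "d < 1"
  proof (rule ccontr)
    assume "\<not> d < 1"
    then have "d = 1 \<or> 1 < d" by auto
    then have "x \<in> P"
    proof
      assume "d = 1" then show ?thesis using yP by simp
    next
      assume "1 < d" then show ?thesis using d(3)[of 1] rel_interior_subset by fastforce
    qed
    then show False using xP by simp
  qed
  have "z + d *\<^sub>R (x - z) = (1 - d) *\<^sub>R z + d *\<^sub>R x" by (simp add: algebra_simps)
  then have "(1 - d) * height F z + d * height F x = 0" using y0 by (simp add: height_line)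
  moreover have "0 < (1 - d) * height F z" using \<open>d < 1\<close> z_pos by simp
  moreover have "0 \<le> d * height F x" using d(1) h[OF F(1)] by simp
  ultimately show False by linarith
qed

text \<open>If all heights agreed at \<open>x\<close> and \<open>y\<close>, the line through \<open>x\<close> and
  \<open>y\<close> would lie in the bounded set \<open>P\<close>.\<close>

lemma height_inj:
  assumes x: "x \<in> P" and y: "y \<in> P" and eq: "\<And>F. F \<in> facets \<Longrightarrow> height F x = height F y"
  shows "x = y"
proof (rule ccontr)
  assume "x \<noteq> y"
  then have n: "0 < norm (y - x)" by simp
  obtain B where B: "\<And>p. p \<in> P \<Longrightarrow> norm p \<le> B" using bounded bounded_iff by blast
  \<comment> \<open>Chosen so that the point with parameter \<open>t\<close> on the line has norm above the bound \<open>B\<close>.\<close>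
  define t where "t = (B + norm x + 1) / norm (y - x)"
  have "(1 - t) *\<^sub>R x + t *\<^sub>R y \<in> P"
  proof (rule in_polytopeI)
    show "(1 - t) *\<^sub>R x + t *\<^sub>R y \<in> affine hull P"
      using x y by (intro mem_affine affine_affine_hull) (auto simp: hull_inc)
    show "0 \<le> height F ((1 - t) *\<^sub>R x + t *\<^sub>R y)" if "F \<in> facets" for F
    proof -
      have "height F ((1 - t) *\<^sub>R x + t *\<^sub>R y) = height F y"
        unfolding height_line eq[OF that] by (simp add: algebra_simps)
      then show ?thesis using height_nonneg[OF that y] by simp
    qed
  qed
  then have le: "norm (x + t *\<^sub>R (y - x)) \<le> B" using B by (simp add: algebra_simps)
  have B0: "0 \<le> B" using B[OF x] norm_ge_zero[of x] by linarith
  have "norm (t *\<^sub>R (y - x)) \<le> norm (x + t *\<^sub>R (y - x)) + norm x"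
    using norm_triangle_ineq4[of "x + t *\<^sub>R (y - x)" x] by simp
  moreover have "norm (t *\<^sub>R (y - x)) = B + norm x + 1"
    using n B0 by (simp add: t_def)
  ultimately show False using le by linarith
qed

lemma lattice_points_eq:
  "lattice_points P = {x \<in> affine_lattice. \<forall>F\<in>facets. 0 \<le> lattice_height F x}"
proof (intro Set.set_eqI iffI)
  fix x assume "x \<in> lattice_points P"
  then have "x \<in> P" "x \<in> affine_lattice"
    by (auto simp: lattice_points_def affine_lattice_def hull_inc)
  then show "x \<in> {x \<in> affine_lattice. \<forall>F\<in>facets. 0 \<le> lattice_height F x}"
    using height_nonneg by (auto simp: lattice_height_def)
next
  fix x assume "x \<in> {x \<in> affine_lattice. \<forall>F\<in>facets. 0 \<le> lattice_height F x}"
  then have x: "x \<in> affine_lattice" and "\<And>F. F \<in> facets \<Longrightarrow> 0 \<le> height F x"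
    by (auto simp: lattice_height_def)
  then have "x \<in> P" using in_polytopeI by (auto simp: affine_lattice_def)
  then show "x \<in> lattice_points P" using x by (auto simp: lattice_points_def affine_lattice_def)
qed

lemma lattice_pointD:
  assumes "x \<in> lattice_points P"
  shows "x \<in> P" "x \<in> int_lattice" "x \<in> affine_lattice"
    "F \<in> facets \<Longrightarrow> of_int (lattice_height F x) = height F x"
  using assms of_int_lattice_height
  by (auto simp: lattice_points_def affine_lattice_def hull_inc)

sublocale facet_system affine_lattice facets lattice_height "lattice_points P"
proof
  show "finite facets" unfolding facets_def by (rule finite_polyhedron_facets[OF polyhedron])
  show "x + (y - z) \<in> affine_lattice" if "x \<in> affine_lattice" "y \<in> affine_lattice" "z \<in> affine_lattice" for x y z
    using that by (rule affine_lattice_closed)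
  show "lattice_height F (x + (y - z)) = lattice_height F x + (lattice_height F y - lattice_height F z)"
    if F: "F \<in> facets" and xyz: "x \<in> affine_lattice" "y \<in> affine_lattice" "z \<in> affine_lattice" for F x y z
  proof -
    have "real_of_int (lattice_height F (x + (y - z)))
        = of_int (lattice_height F x + (lattice_height F y - lattice_height F z))"
      using xyz affine_lattice_closed[OF xyz] by (simp add: of_int_lattice_height[OF F] height_add_diff)
    then show ?thesis by (simp only: of_int_eq_iff)
  qed
  show "lattice_points P = {x \<in> affine_lattice. \<forall>F\<in>facets. 0 \<le> lattice_height F x}"
    by (rule lattice_points_eq)
  show "lattice_height F x \<le> 1" if "x \<in> lattice_points P" "F \<in> facets" for x F
    using height_le_one[OF that(2) lattice_pointD(1)[OF that(1)]] lattice_pointD(4)[OF that] by linarith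
  show "x = y" if x: "x \<in> lattice_points P" and y: "y \<in> lattice_points P"
    and "\<And>F. F \<in> facets \<Longrightarrow> lattice_height F x = lattice_height F y" for x y
    using that(3) lattice_pointD(4)[OF x] lattice_pointD(4)[OF y]
    by (intro height_inj[OF lattice_pointD(1)[OF x] lattice_pointD(1)[OF y]]) metis
qed

text \<open>Heights on \<open>P\<close> lie between \<open>0\<close> and \<open>1\<close>, so both extreme values cut
  out faces.\<close>

lemma height_eq_on_segment:
  assumes F: "F \<in> facets" and x: "x \<in> open_segment p q" and p: "p \<in> P" and q: "q \<in> P"
    and 01: "height F x = 0 \<or> height F x = 1"
  shows "height F p = height F x" "height F q = height F x"
proof -
  obtain r where r: "0 < r" "r < 1" "x = (1 - r) *\<^sub>R p + r *\<^sub>R q" using x by (auto simp: in_segment)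
  have hx: "height F x = (1 - r) * height F p + r * height F q" by (simp add: r(3) height_line)
  note b = height_nonneg[OF F p] height_nonneg[OF F q] height_le_one[OF F p] height_le_one[OF F q]
  have "height F p = height F x \<and> height F q = height F x"
    using 01
  proof
    assume 0: "height F x = 0"
    have "0 \<le> (1 - r) * height F p" "0 \<le> r * height F q" using b r by simp_all
    then have "(1 - r) * height F p = 0" "r * height F q = 0" using hx 0 by linarith+
    then show ?thesis using r 0 by simp
  next
    assume 1: "height F x = 1"
    have "(1 - r) * (1 - height F p) + r * (1 - height F q) = 0" using hx 1 by (simp add: algebra_simps)
    moreover have "0 \<le> (1 - r) * (1 - height F p)" "0 \<le> r * (1 - height F q)" using b r by simp_all
    ultimately have "(1 - r) * (1 - height F p) = 0" "r * (1 - height F q) = 0" by linarith+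
    then show ?thesis using r 1 by simp
  qed
  then show "height F p = height F x" "height F q = height F x" by auto
qed

lemma lattice_point_height_cases:
  assumes "x \<in> lattice_points P" "F \<in> facets"
  shows "height F x = 0 \<or> height F x = 1"
  using height_cases[OF assms] lattice_pointD(4)[OF assms] by auto

text \<open>A point with heights \<open>0\<close> and \<open>1\<close> is extreme as a vertex of the cube is: points
  of \<open>P\<close> on either side of it would have the same heights.\<close>

lemma lattice_point_extreme:
  assumes x: "x \<in> lattice_points P"
  shows "x extreme_point_of P"
  unfolding extreme_point_of_def
proof (intro conjI ballI notI)
  show "x \<in> P" using x by (rule lattice_pointD)
  fix p q assume p: "p \<in> P" and q: "q \<in> P" and seg: "x \<in> open_segment p q"
  have "p = q"
    using height_eq_on_segment[OF _ seg p q lattice_point_height_cases[OF x]]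
    by (intro height_inj[OF p q]) auto
  then show False using seg by simp
qed

lemma extreme_point_iff: "x extreme_point_of P \<longleftrightarrow> x \<in> lattice_points P"
  using lattice_point_extreme extreme_point_lattice
  by (auto simp: lattice_points_def extreme_point_of_def)

text \<open>The smallest face \<open>E\<close> that contains \<open>a\<close> and \<open>b\<close> is the convex hull
  of its vertices. These are lattice points, hence \<open>a\<close> and \<open>b\<close> are the only ones.\<close>

lemma adjacent_imp_neighbours:
  assumes "adjacent a b"
  shows "neighbours P a b"
proof -
  have a: "a \<in> lattice_points P" and b: "b \<in> lattice_points P" and ab: "a \<noteq> b"
    and only: "\<And>c. \<lbrakk>c \<in> lattice_points P;
        \<forall>F\<in>facets. lattice_height F a = lattice_height F b \<longrightarrow> lattice_height F c = lattice_height F a\<rbrakk>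
        \<Longrightarrow> c = a \<or> c = b"
    using assms unfolding adjacent_def by blast+
  define \<Psi> where "\<Psi> = {F \<in> facets. height F a = height F b}"
  define E where "E = {x \<in> P. \<forall>F\<in>\<Psi>. height F x = height F a}"
  have face: "E face_of P"
    unfolding face_of_def
  proof (intro conjI ballI impI)
    show "E \<subseteq> P" by (auto simp: E_def)
    show "Convex.convex E"
    proof (rule convexI)
      fix x y and s t :: real assume xy: "x \<in> E" "y \<in> E" and st: "0 \<le> s" "0 \<le> t" "s + t = 1"
      have "s *\<^sub>R x + t *\<^sub>R y \<in> P" using xy st convex by (auto simp: E_def convex_def)
      moreover have "height F (s *\<^sub>R x + t *\<^sub>R y) = height F a" if "F \<in> \<Psi>" for F
      proof -
        have s: "s = 1 - t" using st(3) by simp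
        show ?thesis unfolding s height_line using xy that by (simp add: E_def algebra_simps)
      qed
      ultimately show "s *\<^sub>R x + t *\<^sub>R y \<in> E" by (simp add: E_def)
    qed
    fix p q x assume p: "p \<in> P" and q: "q \<in> P" and x: "x \<in> E" "x \<in> open_segment p q"
    have "height F p = height F a \<and> height F q = height F a" if F: "F \<in> \<Psi>" for F
    proof -
      have eq: "height F x = height F a" and F': "F \<in> facets" using x(1) F by (auto simp: E_def \<Psi>_def)
      show ?thesis
        using height_eq_on_segment[OF F' x(2) p q] lattice_point_height_cases[OF a F'] unfolding eq by blast
    qed
    then show "p \<in> E" "q \<in> E" using p q by (auto simp: E_def)
  qed
  have abE: "a \<in> E" "b \<in> E" using a b by (auto simp: E_def \<Psi>_def dest: lattice_pointD(1))
  have "{x. x extreme_point_of E} \<subseteq> {a, b}"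
  proof
    fix c assume "c \<in> {x. x extreme_point_of E}"
    then have c: "c \<in> lattice_points P" "c \<in> E"
      using extreme_point_of_face[OF face] extreme_point_iff by auto
    have "lattice_height F c = lattice_height F a" if "F \<in> facets" "lattice_height F a = lattice_height F b" for F
    proof -
      have "F \<in> \<Psi>" using that lattice_pointD(4)[OF a that(1)] lattice_pointD(4)[OF b that(1)] by (auto simp: \<Psi>_def)
      then have "height F c = height F a" using c(2) by (simp add: E_def)
      then show ?thesis by (simp add: lattice_height_def)
    qed
    then show "c \<in> {a, b}" using only[OF c(1)] by blast
  qed
  then have "convex hull {x. x extreme_point_of E} \<subseteq> convex hull {a, b}" by (rule hull_mono)
  moreover have "E = convex hull {x. x extreme_point_of E}"
    using face_of_polytope_polytope[OF polytope face] face_of_imp_convex[OF face]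
    by (intro Krein_Milman_Minkowski polytope_imp_compact)
  moreover have "convex hull {a, b} \<subseteq> E"
    using abE face_of_imp_convex[OF face] by (intro hull_minimal) auto
  ultimately have "E = convex hull {a, b}" by blast
  then have "aff_dim E = 1" using ab by (simp add: aff_dim_convex_hull)
  then have edge: "E edge_of P" using face by (simp add: edge_of_def)
  have "open_segment a b \<inter> int_lattice = {}"
  proof (rule ccontr)
    assume "open_segment a b \<inter> int_lattice \<noteq> {}"
    then obtain c where c: "c \<in> open_segment a b" "c \<in> int_lattice" by blast
    have aP: "a \<in> P" and bP: "b \<in> P" using a b by (auto dest: lattice_pointD(1))
    have "c \<in> P"
      using c(1) convex_contains_open_segment[of P] convex aP bP by blast
    then have "c extreme_point_of P" using c(2) by (simp add: extreme_point_iff lattice_points_def)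
    then show False using c(1) aP bP unfolding extreme_point_of_def by blast
  qed
  then show ?thesis
    unfolding neighbours_def is_vertex_def using edge abE a b ab by (auto simp: extreme_point_iff)
qed

text \<open>At a smooth vertex the ray generators have dual vectors \<open>f u\<close>, and these are the coordinates
  of the cone at \<open>v\<close>. A facet \<open>F\<close> at \<open>v\<close> is not parallel to all rays;
  pick a ray \<open>u0\<close> that leaves it. Both \<open>F\<close> and any other facet at \<open>v\<close>
  that \<open>u0\<close> leaves would coincide with the face where the coordinate of \<open>u0\<close>
  vanishes, since facets are maximal proper faces. So \<open>u0\<close> stays on all other facets, and the
  vertex \<open>y\<close> of \<open>P\<close> in the direction \<open>u0\<close> is the required lattice
  point.\<close>

lemma smooth_vertex_imp_simple:
  assumes "smooth_vertex P v"
  shows "simple_point v"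
  unfolding simple_point_def
proof (intro conjI ballI impI)
  have vx: "v extreme_point_of P" using assms by (simp add: smooth_vertex_def is_vertex_def)
  then show vL: "v \<in> lattice_points P" by (simp add: extreme_point_iff)
  obtain B where B: "int_basis B" "ray_generators (vertex_cone P v) \<subseteq> B"
    using assms unfolding smooth_vertex_def by blast
  obtain V where V: "finite V" "V \<subseteq> int_lattice" "P = convex hull V"
    using lattice unfolding lattice_polytope_def by blast
  define R where "R = ray_generators (vertex_cone P v)"
  have "finite B" using B(1) by (simp add: int_basis_def)
  then have finR: "finite R" using finite_subset[OF B(2)] by (simp add: R_def)
  have RC: "u \<in> vertex_cone P v" if "u \<in> R" for u
    using that edge_of_imp_subset[of _ "vertex_cone P v"] by (auto simp: R_def ray_generators_def)
  have gen: "vertex_cone P v \<subseteq> nonneg_combinations R"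
    using vertex_cone_generated[OF V(1,2), of v R] vx finR unfolding V(3)[symmetric] R_def by simp
  have "\<forall>u. \<exists>f. u \<in> R \<longrightarrow> f \<bullet> u = 1 \<and> (\<forall>u'\<in>R. u' \<noteq> u \<longrightarrow> f \<bullet> u' = 0)"
  proof
    fix u
    show "\<exists>f. u \<in> R \<longrightarrow> f \<bullet> u = 1 \<and> (\<forall>u'\<in>R. u' \<noteq> u \<longrightarrow> f \<bullet> u' = 0)"
    proof (cases "u \<in> R")
      case True
      then have "u \<in> B" using B(2) by (auto simp: R_def)
      then obtain f where "f \<bullet> u = 1" "\<And>b'. b' \<in> B \<Longrightarrow> b' \<noteq> u \<Longrightarrow> f \<bullet> b' = 0"
        using int_basis_dual[OF B(1)] by blast
      then show ?thesis using B(2) unfolding R_def by blast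
    qed blast
  qed
  then obtain f where f: "\<And>u. u \<in> R \<Longrightarrow> f u \<bullet> u = 1"
    "\<And>u u'. u \<in> R \<Longrightarrow> u' \<in> R \<Longrightarrow> u' \<noteq> u \<Longrightarrow> f u \<bullet> u' = 0" by metis
  have coords: "(\<forall>u\<in>R. 0 \<le> f u \<bullet> x) \<and> x = (\<Sum>u\<in>R. (f u \<bullet> x) *\<^sub>R u)" if xC: "x \<in> vertex_cone P v" for x
  proof -
    have "x \<in> nonneg_combinations R" using xC gen by blast
    then obtain c where c: "\<forall>u\<in>R. 0 \<le> c u" "x = (\<Sum>u\<in>R. c u *\<^sub>R u)"
      unfolding nonneg_combinations_def by blast
    have fc: "f u \<bullet> x = c u" if u: "u \<in> R" for u
    proof -
      have "f u \<bullet> x = (\<Sum>u'\<in>R. c u' * (f u \<bullet> u'))" by (simp add: c(2) inner_sum_right)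
      also have "\<dots> = (\<Sum>u'\<in>R. if u' = u then c u else 0)" using f u by (intro sum.cong) auto
      also have "\<dots> = c u" using finR u by simp
      finally show ?thesis .
    qed
    have "(\<Sum>u\<in>R. (f u \<bullet> x) *\<^sub>R u) = (\<Sum>u\<in>R. c u *\<^sub>R u)" using fc by (intro sum.cong) auto
    then show ?thesis using fc c by auto
  qed
  define slope where "slope G x = fst (facet_data G) \<bullet> x" for G x
  have slope_height: "slope G (x - v) = height G x" if "height G v = 0" for G x
    using that by (simp add: slope_def height_def inner_diff_right inner_commute[of "fst (facet_data G)"])
  have slope_nonneg: "0 \<le> slope G x" if G: "G \<in> facets" "height G v = 0" and x: "x \<in> vertex_cone P v" for G x
  proof -
    obtain l p where "x = l *\<^sub>R (p - v)" "0 \<le> l" "p \<in> P" using x by (auto simp: vertex_cone_def)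
    moreover have "slope G (l *\<^sub>R (p - v)) = l * slope G (p - v)" for l p by (simp add: slope_def)
    ultimately show ?thesis using slope_height[OF G(2)] height_nonneg[OF G(1)] by simp
  qed
  have slope_expand: "slope G x = (\<Sum>u\<in>R. (f u \<bullet> x) * slope G u)" if "x \<in> vertex_cone P v" for G x
  proof -
    have "slope G x = slope G (\<Sum>u\<in>R. (f u \<bullet> x) *\<^sub>R u)" using coords[OF that] by simp
    then show ?thesis by (simp add: slope_def inner_sum_right)
  qed
  fix F assume F: "F \<in> facets" and v0: "lattice_height F v = 0"
  have hv: "height F v = 0" using v0 lattice_pointD(4)[OF vL F] by simp
  have "F \<noteq> P" using F by (auto simp: facets_def)
  then obtain x where x: "x \<in> P" "height F x \<noteq> 0" using facet_eq[OF F] by blast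
  then have "0 < slope F (x - v)" using slope_height[OF hv] height_nonneg[OF F x(1)] by simp
  then have "(\<Sum>u\<in>R. (f u \<bullet> (x - v)) * slope F u) \<noteq> 0"
    using slope_expand[OF vertex_cone_base[OF x(1)]] by simp
  then obtain u0 where u0: "u0 \<in> R" "slope F u0 \<noteq> 0"
    by (metis (no_types, lifting) mult_zero_right sum.neutral)
  then have slope_pos: "0 < slope F u0" using slope_nonneg[OF F hv RC] by fastforce
  obtain l p where l: "u0 = l *\<^sub>R (p - v)" "0 \<le> l" "p \<in> P" using RC[OF u0(1)] by (auto simp: vertex_cone_def)
  obtain \<mu> where \<mu>: "\<forall>w\<in>V. 0 \<le> \<mu> w" "sum \<mu> V = 1" "(\<Sum>w\<in>V. \<mu> w *\<^sub>R w) = p"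
    using l(3) unfolding V(3) convex_hull_finite[OF V(1)] by blast
  have "p - v = (\<Sum>w\<in>V. \<mu> w *\<^sub>R (w - v))"
    using \<mu>(2,3) by (simp add: scaleR_diff_right sum_subtractf flip: scaleR_left.sum)
  then have u0_sum: "g \<bullet> u0 = (\<Sum>w\<in>V. l * \<mu> w * (g \<bullet> (w - v)))" for g
    by (simp add: l(1) inner_sum_right sum_distrib_left mult.assoc)
  have VP: "V \<subseteq> P" unfolding V(3) by (rule hull_subset)
  have VC: "w - v \<in> vertex_cone P v" if "w \<in> V" for w using that VP by (intro vertex_cone_base) auto
  \<comment> \<open>The points of \<open>V\<close> that occur in \<open>u0\<close> with positive weight lie on the ray of \<open>u0\<close>, as their coordinates cannot cancel.\<close>
  have "(\<Sum>w\<in>V. l * \<mu> w * (f u0 \<bullet> (w - v))) \<noteq> 0" using u0_sum[of "f u0"] f(1)[OF u0(1)] by simp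
  then obtain y where y: "y \<in> V" "l * \<mu> y * (f u0 \<bullet> (y - v)) \<noteq> 0" by (metis (no_types, lifting) sum.neutral)
  have y_coord0: "f u \<bullet> (y - v) = 0" if u: "u \<in> R" "u \<noteq> u0" for u
  proof -
    have "(\<Sum>w\<in>V. l * \<mu> w * (f u \<bullet> (w - v))) = 0" using u0_sum[of "f u"] f(2)[OF u(1) u0(1)] u(2) by simp
    moreover have "0 \<le> l * \<mu> w * (f u \<bullet> (w - v))" if "w \<in> V" for w
      using coords[OF VC[OF that]] u(1) l(2) \<mu>(1) that by simp
    ultimately have "l * \<mu> y * (f u \<bullet> (y - v)) = 0" using y(1) V(1) by (auto simp: sum_nonneg_eq_0_iff)
    then show ?thesis using y(2) by simp
  qed
  \<comment> \<open>All coordinates of \<open>y - v\<close> except the one of \<open>u0\<close> vanish, so \<open>y - v\<close> is \<open>t\<close> times \<open>u0\<close>.\<close>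
  define t where "t = f u0 \<bullet> (y - v)"
  have t: "0 < t" using coords[OF VC[OF y(1)]] u0(1) y(2) unfolding t_def by (metis mult_zero_right order_le_less)
  have slope_y: "slope G (y - v) = t * slope G u0" for G
  proof -
    have "slope G (y - v) = (\<Sum>u\<in>R. if u = u0 then t * slope G u0 else 0)"
      unfolding slope_expand[OF VC[OF y(1)]] using y_coord0 by (intro sum.cong) (auto simp: t_def)
    then show ?thesis using finR u0(1) by simp
  qed
  have yL: "y \<in> lattice_points P" using y(1) V(2) VP by (auto simp: lattice_points_def)
  show "\<exists>y\<in>lattice_points P. lattice_height F y = 1 \<and>
      (\<forall>F'\<in>facets - {F}. lattice_height F' v = 0 \<longrightarrow> lattice_height F' y = 0)"
  proof (intro bexI[OF _ yL] conjI ballI impI)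
    have "0 < height F y" using slope_y[of F] slope_height[OF hv] t slope_pos by simp
    then show "lattice_height F y = 1"
      using lattice_point_height_cases[OF yL F] by (auto simp: lattice_height_def)
    fix F' assume F': "F' \<in> facets - {F}" and v0': "lattice_height F' v = 0"
    have hv': "height F' v = 0" using v0' lattice_pointD(4)[OF vL, of F'] F' by simp
    define E where "E = P \<inter> {x. f u0 \<bullet> x = f u0 \<bullet> v}"
    have E_face: "E face_of P"
      unfolding E_def
    proof (rule face_of_Int_supporting_hyperplane_ge[OF convex])
      fix x assume "x \<in> P"
      then have "0 \<le> f u0 \<bullet> (x - v)" using coords[OF vertex_cone_base[of x P v]] u0(1) by blast
      then show "f u0 \<bullet> v \<le> f u0 \<bullet> x" by (simp add: inner_diff_right)
    qed
    have "y \<notin> E" using t by (simp add: E_def t_def inner_diff_right)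
    then have "E \<noteq> P" using y(1) VP by blast
    have facet_E: "G = E" if G: "G \<in> facets" "height G v = 0" "0 < slope G u0" for G
    proof -
      have "G \<subseteq> E"
      proof
        fix x assume "x \<in> G"
        then have x: "x \<in> P" "height G x = 0" using facet_eq[OF G(1)] by blast+
        have xC: "x - v \<in> vertex_cone P v" using x(1) by (rule vertex_cone_base)
        have "(\<Sum>u\<in>R. (f u \<bullet> (x - v)) * slope G u) = 0"
          using slope_expand[OF xC, of G] slope_height[OF G(2), of x] x(2) by linarith
        moreover have "0 \<le> (f u \<bullet> (x - v)) * slope G u" if "u \<in> R" for u
          using coords[OF xC] slope_nonneg[OF G(1,2) RC] that by simp
        ultimately have "(f u0 \<bullet> (x - v)) * slope G u0 = 0"
          using finR u0(1) by (simp add: sum_nonneg_eq_0_iff)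
        then have "f u0 \<bullet> (x - v) = 0" using G(3) by simp
        then show "x \<in> E" using x(1) by (simp add: E_def inner_diff_right)
      qed
      have GP: "G face_of P" "aff_dim G = aff_dim P - 1" using G(1) by (auto simp: facets_def facet_of_def)
      have "G face_of E" using face_of_subset[OF GP(1) \<open>G \<subseteq> E\<close>] by (simp add: E_def)
      moreover have "aff_dim E < aff_dim P" using face_of_aff_dim_lt[OF convex E_face \<open>E \<noteq> P\<close>] .
      ultimately show ?thesis
        using face_of_aff_dim_lt[of E G] face_of_imp_convex[OF E_face] GP(2) by fastforce
    qed
    have "\<not> 0 < slope F' u0" using facet_E[of F'] facet_E[of F] F F' hv hv' slope_pos by blast
    then have "slope F' u0 = 0" using slope_nonneg[of F' u0] F' hv' RC[OF u0(1)] by fastforce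
    then have "height F' y = 0" using slope_y[of F'] slope_height[OF hv'] by simp
    then show "lattice_height F' y = 0" by (simp add: lattice_height_def)
  qed
qed

end

theorem theorem5p7:
  fixes P :: "(real ^ 'n) set"
  assumes "lattice_polytope P"
    and "compressed P"
    and "\<not> (\<exists>v w. singular_vertex P v \<and> singular_vertex P w \<and> neighbours P v w)"
  shows "toric_ideal P =
           genideal (coordinate_ring (lattice_points P))
             {f \<in> toric_ideal P. homogeneous_of_degree 2 f}"
proof -
  interpret compressed_polytope P using assms(1,2) by unfold_locales
  have simple_point: "simple_point a \<or> simple_point b" if "adjacent a b" for a b
  proof -
    have "neighbours P a b" using that by (rule adjacent_imp_neighbours)
    then have "smooth_vertex P a \<or> smooth_vertex P b"
      using assms(3) unfolding neighbours_def singular_vertex_def by blast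
    then show ?thesis using smooth_vertex_imp_simple by blast
  qed
  show ?thesis
    by (rule toric_ideal_generated_by_quadrics) (rule exchange_equiv_fibre[OF simple_point])
qed

end
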